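(* Let $(S_n)$ be the multidimensional elephant random walk with stops on $\mathbb{Z}^d$ with parameters $p,q\in[0,1]$, $r\in(0,1)$, $p+(2d-1)q+r=1$, in the critical regime $p=p_{d,r}$, where $p_{d,r}=\left(\frac{2d+1}{4d}\right)(1-r)$. Then $$\lim_{n\to\infty}\frac1n S_n=0\quad\text{almost surely.}$$ More precisely, $$\frac{\|S_n\|^2}{n^2}=O\left(\frac{\log n\,\log\log n}{n^{1+r}}\right)\quad\text{almost surely.}$$
   Context: Multidimensional elephant random walk with stops (MERWS). Let $d\ge1$ be an integer and $p,q\in[0,1]$, $r\in(0,1)$ with $p+(2d-1)q+r=1$. Let $I_d$ be the $d\times d$ identity matrix and $J_d$ the $d\times d$ cyclic permutation matrix with $(J_d)_{i,i+1}=1$ for $1\le i\le d-1$, $(J_d)_{d,1}=1$, and all other entries $0$. Let $(e_1,\dots,e_d)$ be the standard basis of $\mathbb{R}^d$. Set $S_0=0$, let $X_1$ be uniformly distributed on the $2d$ vectors $\pm e_1,\dots,\pm e_d$, and $S_1=X_1$. For all $n\ge1$, $X_{n+1}=A_{n+1}X_{U_{n+1}}$ and $S_{n+1}=S_n+X_{n+1}$, where $U_{n+1}$ is uniformly distributed on $\{1,\dots,n\}$ and $A_{n+1}$ is a random matrix equal to $I_d$ with probability $p$, to $-I_d$ with probability $q$, to each of $J_d^i$ and $-J_d^i$ ($1\le i\le d-1$) with probability $q$, and to the zero matrix with probability $r$; $A_{n+1}$ and $U_{n+1}$ are independent of each other and of $\mathcal{F}_n=\sigma(X_1,\dots,X_n)$.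 $\|\cdot\|$ is the Euclidean norm. "$Y_n=O(c_n)$ almost surely" means that, almost surely, $|Y_n|/c_n$ is bounded for $n$ large (by a possibly random finite constant). *)

theory Defs
  imports "HOL-Probability.Probability"
begin

text \<open>
  The coordinates $1,\dots,d$ are represented by a finite linearly ordered index type
  with $d$ elements; \<open>coord_pos\<close> is the order isomorphism onto $\{1,\dots,d\}$.
\<close>

definition coord_pos :: "'d::{finite,linorder} \<Rightarrow> nat"
  where "coord_pos i = card {k. k \<le> i}"

definition cyclic_perm_matrix :: "real ^ ('d::{finite,linorder}) ^ ('d::{finite,linorder})"
  where "cyclic_perm_matrix = (\<chi> i j.
    if coord_pos j = coord_pos i + 1 \<or> coord_pos i = CARD('d) \<and> coord_pos j = 1 then 1 else 0)"

text \<open>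
  The class operations \<open>*\<close> and \<open>1\<close> on type \<^typ>\<open>real ^ 'd ^ 'd\<close> are
  entrywise, so powers of a matrix are built from \<open>**\<close> and \<open>mat 1\<close>.
\<close>

definition matrix_power :: "real ^ 'd ^ 'd \<Rightarrow> nat \<Rightarrow> real ^ 'd ^ 'd"
  where "matrix_power B n = (((**) B) ^^ n) (mat 1)"

text \<open>
  The relevant indices are \<open>n \<ge> 1\<close> for \<open>X\<close>, \<open>n \<ge> 2\<close> for \<open>U\<close> and \<open>A\<close>, and
  \<open>n \<ge> 0\<close> for \<open>S\<close>; nothing is assumed about the other values.
\<close>

locale merws = prob_space M
  for M :: "'a measure" +
  fixes p q r :: real
    and X :: "nat \<Rightarrow> 'a \<Rightarrow> real ^ ('d::{finite,linorder})"
    and U :: "nat \<Rightarrow> 'a \<Rightarrow> nat"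
    and A :: "nat \<Rightarrow> 'a \<Rightarrow> real ^ ('d::{finite,linorder}) ^ ('d::{finite,linorder})"
    and S :: "nat \<Rightarrow> 'a \<Rightarrow> real ^ ('d::{finite,linorder})"
  assumes p_range: "0 \<le> p" "p \<le> 1"
    and q_range: "0 \<le> q" "q \<le> 1"
    and r_range: "0 < r" "r < 1"
    and pqr_sum: "p + (2 * real CARD('d) - 1) * q + r = 1"
    and X_rv: "\<And>n. n \<ge> 1 \<Longrightarrow> random_variable borel (X n)"
    and U_rv: "\<And>n. n \<ge> 1 \<Longrightarrow> random_variable (count_space UNIV) (U (Suc n))"
    and A_rv: "\<And>n. n \<ge> 1 \<Longrightarrow> random_variable borel (A (Suc n))"
    and X_1_pos: "\<And>i. prob {\<omega> \<in> space M. X 1 \<omega> = axis i 1} = 1 / (2 * real CARD('d))"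
    and X_1_neg: "\<And>i. prob {\<omega> \<in> space M. X 1 \<omega> = - axis i 1} = 1 / (2 * real CARD('d))"
    and U_uniform: "\<And>n k. n \<ge> 1 \<Longrightarrow> k \<in> {1..n} \<Longrightarrow>
          prob {\<omega> \<in> space M. U (Suc n) \<omega> = k} = 1 / real n"
    and A_id: "\<And>n. n \<ge> 1 \<Longrightarrow> prob {\<omega> \<in> space M. A (Suc n) \<omega> = mat 1} = p"
    and A_neg_id: "\<And>n. n \<ge> 1 \<Longrightarrow> prob {\<omega> \<in> space M. A (Suc n) \<omega> = - mat 1} = q"
    and A_cyclic: "\<And>n i. n \<ge> 1 \<Longrightarrow> 1 \<le> i \<Longrightarrow> i \<le> CARD('d) - 1 \<Longrightarrow>
          prob {\<omega> \<in> space M. A (Suc n) \<omega> = matrix_power cyclic_perm_matrix i} = q"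
    and A_neg_cyclic: "\<And>n i. n \<ge> 1 \<Longrightarrow> 1 \<le> i \<Longrightarrow> i \<le> CARD('d) - 1 \<Longrightarrow>
          prob {\<omega> \<in> space M. A (Suc n) \<omega> = - matrix_power cyclic_perm_matrix i} = q"
    and A_zero: "\<And>n. n \<ge> 1 \<Longrightarrow> prob {\<omega> \<in> space M. A (Suc n) \<omega> = 0} = r"
    \<comment> \<open>mutual independence of \<open>A (n + 1)\<close>, \<open>U (n + 1)\<close> and \<open>\<sigma>(X 1, \<dots>, X n)\<close>\<close>
    and independence: "\<And>n. n \<ge> 1 \<Longrightarrow>
          indep_sets ((!)
            [ sets (vimage_algebra (space M) (A (Suc n)) borel),
              sets (vimage_algebra (space M) (U (Suc n)) (count_space UNIV)),
              sigma_sets (space M)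
                (\<Union>k\<in>{1..n}. sets (vimage_algebra (space M) (X k) borel)) ]) {..<3}"
    and X_step: "\<And>n \<omega>. n \<ge> 1 \<Longrightarrow> \<omega> \<in> space M \<Longrightarrow>
          X (Suc n) \<omega> = A (Suc n) \<omega> *v X (U (Suc n) \<omega>) \<omega>"
    and S_0: "\<And>\<omega>. \<omega> \<in> space M \<Longrightarrow> S 0 \<omega> = 0"
    and S_1: "\<And>\<omega>. \<omega> \<in> space M \<Longrightarrow> S 1 \<omega> = X 1 \<omega>"
    and S_step: "\<And>n \<omega>. n \<ge> 1 \<Longrightarrow> \<omega> \<in> space M \<Longrightarrow> S (Suc n) \<omega> = S n \<omega> + X (Suc n) \<omega>"

definition critical_p :: "nat \<Rightarrow> real \<Rightarrow> real"
  where "critical_p d r = (2 * real d + 1) / (4 * real d) * (1 - r)"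

end

theory Submission
  imports Defs "HOL-Real_Asymp.Real_Asymp"
begin

text \<open>
  Write \<open>a = (1 - r) / 2\<close>. Averaging over the random matrix cancels every rotation other
  than the identity, since it appears with both signs and the same probability, and leaves
  \<open>(p - q) I\<close>. In the critical regime \<open>p - q = a\<close>, so the conditional mean of \<open>X (n + 1)\<close>
  given the past is \<open>a / n * S n\<close>. Hence, with \<open>growth n\<close> the product of the factors
  \<open>1 + a / k\<close> for \<open>1 \<le> k < n\<close>, which is \<open>O(n powr a)\<close>, every coordinate of \<open>S n / growth n\<close>
  is a martingale.

  Its size is governed by \<open>moves n\<close>, the number of steps up to time \<open>n\<close> that are not stops:
  a new step moves with conditional probability \<open>2 * a / n * moves n\<close>. This gives
  \<open>E (moves n) \<le> (growth n)^2\<close> and \<open>E ((moves n)^2) \<le> 2 * (growth n)^4\<close>, so that the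
  martingale increments have variance at most of order \<open>1 / n\<close>. A fourth-moment recursion
  then bounds the fourth moment of the martingale by a constant times \<open>(1 + ln n)^2\<close> (lemma
  \<open>expectation_S4\<close>).

  The factor \<open>ln (ln n)\<close> in the claim leaves enough room to replace exponential inequalities
  by this fourth moment. Along the times \<open>exp (2^j)\<close> the maximal inequality for the
  submartingale given by the fourth power (lemma \<open>quartic_maximal\<close>) shows that the squared
  martingale exceeds \<open>2^j * j\<close> before time \<open>exp (2^j)\<close> with probability at most of order
  \<open>1 / j^2\<close>; the second moment would only give the divergent \<open>1 / j\<close>. By the Borel-Cantelli
  lemma only finitely many of these events occur. For \<open>n\<close> between two consecutive such
  times, the later one having index \<open>j\<close>, the number \<open>2^j\<close> is at most \<open>2 * ln n\<close> and \<open>j\<close> is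
  of order \<open>ln (ln n)\<close>, so almost surely each squared coordinate of \<open>S n\<close> is
  \<open>O((growth n)^2 * ln n * ln (ln n))\<close>. Since \<open>(growth n)^2 = O(n powr (1 - r))\<close>, this is
  the asserted rate, and the rate implies convergence to zero.
\<close>

section \<open>The step matrices\<close>

lemma bij_coord_pos: "bij_betw coord_pos (UNIV :: 'd::{finite,linorder} set) {1..CARD('d)}"
proof -
  \<comment> \<open>The position is strictly monotone, hence injective, and so onto by cardinality.\<close>
  have less: "coord_pos i < coord_pos j" if "i < j" for i j :: 'd
    unfolding coord_pos_def
  proof (rule psubset_card_mono)
    have "j \<in> {k. k \<le> j} - {k. k \<le> i}" using that by auto
    thus "{k. k \<le> i} \<subset> {k. k \<le> j}" using that by auto
  qed simp
  have inj: "inj (coord_pos :: 'd \<Rightarrow> nat)"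
    by (rule linorder_injI) (use less in \<open>metis less_irrefl\<close>)
  have "coord_pos i \<in> {1..CARD('d)}" for i :: 'd
  proof -
    have "card {k. k \<le> i} \<le> CARD('d)" by (rule card_mono) auto
    moreover have "card {k. k \<le> i} > 0" by (subst card_gt_0_iff) auto
    ultimately show ?thesis by (auto simp: coord_pos_def)
  qed
  hence "range (coord_pos :: 'd \<Rightarrow> nat) \<subseteq> {1..CARD('d)}" by blast
  moreover have "card (range (coord_pos :: 'd \<Rightarrow> nat)) = CARD('d)"
    using inj by (rule card_image)
  ultimately have "range (coord_pos :: 'd \<Rightarrow> nat) = {1..CARD('d)}"
    by (intro card_subset_eq) auto
  with inj show ?thesis by (simp add: bij_betw_def)
qed

lemma coord_pos_eq_iff: "coord_pos i = coord_pos j \<longleftrightarrow> i = j"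
  using bij_coord_pos by (auto simp: bij_betw_def inj_on_def)

lemma coord_pos_range:
  fixes i :: "'d::{finite,linorder}"
  shows "1 \<le> coord_pos i" "coord_pos i \<le> CARD('d)"
proof -
  have "coord_pos i \<in> {1..CARD('d)}"
    using bij_betwE[OF bij_coord_pos] by blast
  thus "1 \<le> coord_pos i" "coord_pos i \<le> CARD('d)" by auto
qed

lemma coord_pos_surj:
  "1 \<le> m \<Longrightarrow> m \<le> CARD('d::{finite,linorder}) \<Longrightarrow> \<exists>i::'d::{finite,linorder}. coord_pos i = m"
  using bij_betw_imp_surj_on[OF bij_coord_pos] by (metis atLeastAtMost_iff imageE)

lemma cyclic_perm_matrix_axis:
  fixes j j' :: "'d::{finite,linorder}"
  assumes "coord_pos j = coord_pos j' + 1 \<or> coord_pos j' = CARD('d) \<and> coord_pos j = 1"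
  shows "cyclic_perm_matrix *v axis j 1 = axis j' 1"
proof -
  have "(coord_pos j = coord_pos k + 1 \<or> coord_pos k = CARD('d) \<and> coord_pos j = 1) \<longleftrightarrow> k = j'"
    for k :: 'd
    using assms coord_pos_range[of j] coord_pos_range[of k] coord_pos_range[of j']
      coord_pos_eq_iff[of k j'] by auto
  hence "column j (cyclic_perm_matrix :: ((real, 'd) vec, 'd) vec) = axis j' 1"
    unfolding column_def cyclic_perm_matrix_def by (simp add: axis_def vec_eq_iff)
  thus ?thesis
    by (simp only: matrix_vector_mult_basis)
qed

definition rotation :: "nat \<Rightarrow> ((real, 'd::{finite,linorder}) vec, 'd) vec"
  where "rotation i = matrix_power cyclic_perm_matrix i"

lemma rotation_0: "rotation 0 = mat 1"
  by (simp add: rotation_def matrix_power_def)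

lemma rotation_Suc_mult: "rotation (Suc i) *v x = cyclic_perm_matrix *v (rotation i *v x)"
  by (simp add: rotation_def matrix_power_def matrix_vector_mul_assoc)

definition unit_steps :: "((real, 'd::finite) vec) set"
  where "unit_steps = range (\<lambda>i. axis i 1) \<union> range (\<lambda>i. - axis i 1)"

definition step_matrices :: "(((real, 'd::{finite,linorder}) vec, 'd) vec) set"
  where "step_matrices =
    insert 0 (rotation ` {..<CARD('d)} \<union> (\<lambda>i. - rotation i) ` {..<CARD('d)})"

lemma rotation_axis: "\<exists>j'. rotation i *v axis (j::'d::{finite,linorder}) 1 = axis j' 1"
proof (induction i)
  case 0
  show ?case by (auto simp: rotation_0)
next
  case (Suc i)
  then obtain k :: 'd where k: "rotation i *v axis j 1 = axis k 1" by blast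
  show ?case
  proof (cases "coord_pos k = 1")
    case True
    obtain l :: 'd where "coord_pos l = CARD('d)"
      using coord_pos_surj[of "CARD('d)"] by (metis One_nat_def Suc_leI order_refl zero_less_card_finite)
    with True show ?thesis
      using cyclic_perm_matrix_axis[of k l] by (auto simp: rotation_Suc_mult k)
  next
    case False
    obtain l :: 'd where "coord_pos l = coord_pos k - 1"
      using coord_pos_surj[of "coord_pos k - 1"] coord_pos_range[of k] False
      by (metis diff_le_self le_antisym le_trans not_less_eq_eq One_nat_def Suc_pred diff_is_0_eq neq0_conv less_one not_le)
    with False show ?thesis
      using cyclic_perm_matrix_axis[of k l] coord_pos_range[of k] by (auto simp: rotation_Suc_mult k)
  qed
qed

text \<open>
  Following the last basis vector tells the powers apart: in fewer than \<open>d\<close> applications it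
  never wraps around, so its position reveals the exponent.
\<close>
lemma rotation_last_axis:
  fixes j :: "'d::{finite,linorder}"
  assumes "coord_pos j = CARD('d)" "i < CARD('d)"
  shows "\<exists>k. rotation i *v axis j 1 = axis k 1 \<and> coord_pos k = CARD('d) - i"
  using assms(2)
proof (induction i)
  case 0
  show ?case using assms by (auto simp: rotation_0)
next
  case (Suc i)
  then obtain k :: 'd where k: "rotation i *v axis j 1 = axis k 1" "coord_pos k = CARD('d) - i"
    by auto
  obtain l :: 'd where l: "coord_pos l = CARD('d) - Suc i"
    using coord_pos_surj[of "CARD('d) - Suc i"] Suc.prems by (metis Suc_leI One_nat_def zero_less_diff diff_le_self)
  have "rotation (Suc i) *v axis j 1 = axis l 1"
    using cyclic_perm_matrix_axis[of k l] k l Suc.prems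
    by (simp add: rotation_Suc_mult Suc_diff_Suc)
  with l show ?case by blast
qed

lemma axis_neq_minus_axis: "axis i (1::real) \<noteq> - axis j 1" "axis i (1::real) \<noteq> 0"
proof -
  show "axis i (1::real) \<noteq> - axis j 1"
  proof
    assume "axis i (1::real) = - axis j 1"
    hence "axis i (1::real) $ i = (- axis j 1) $ i" by simp
    thus False by (simp add: axis_def split: if_splits)
  qed
qed simp

lemma matrix_vector_mult_uminus:
  fixes B :: "('a::ring_1, 'n::finite) vec ^ 'm::finite"
  shows "(- B) *v x = - (B *v x)" "B *v (- x) = - (B *v x)"
  by (simp_all add: matrix_vector_mult_def vec_eq_iff sum_negf)

text \<open>
  All the matrices offered to the walk are different, so the probabilities prescribed for
  \<open>A (Suc n)\<close> belong to disjoint events and can be added.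
\<close>
lemma rotation_distinct:
  fixes rot :: "nat \<Rightarrow> ((real, 'd::{finite,linorder}) vec, 'd) vec"
  defines "rot \<equiv> rotation"
  shows "inj_on rot {..<CARD('d)}"
    and "rot i \<noteq> - rot k"
    and "rot i \<noteq> 0"
proof -
  obtain j :: 'd where j: "coord_pos j = CARD('d)"
    using coord_pos_surj[of "CARD('d)"] by (metis One_nat_def Suc_leI order_refl zero_less_card_finite)
  show "inj_on rot {..<CARD('d)}"
  proof (rule inj_onI)
    fix i k assume *: "i \<in> {..<CARD('d)}" "k \<in> {..<CARD('d)}"
      "rot i = rot k"
    obtain u where u: "rot i *v axis j 1 = axis u 1" "coord_pos u = CARD('d) - i"
      using rotation_last_axis[OF j, of i] * by (auto simp: rot_def)
    obtain v where v: "rot k *v axis j 1 = axis v 1" "coord_pos v = CARD('d) - k"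
      using rotation_last_axis[OF j, of k] * by (auto simp: rot_def)
    have "u = v" using u v * by (metis axis_eq_axis zero_neq_one)
    thus "i = k" using u v * by auto
  qed
  show "rot i \<noteq> - rot k"
  proof
    assume eq: "rot i = - rot k"
    obtain u v where "rot i *v axis j 1 = axis u 1" "rot k *v axis j 1 = axis v 1"
      using rotation_axis unfolding rot_def by metis
    hence "axis u (1::real) = - axis v 1"
      using eq by (metis matrix_vector_mult_uminus(1))
    thus False using axis_neq_minus_axis by blast
  qed
  show "rot i \<noteq> 0"
  proof
    assume "rot i = 0"
    moreover obtain u where "rot i *v axis j 1 = axis u 1"
      using rotation_axis unfolding rot_def by metis
    ultimately show False using axis_neq_minus_axis(2) by (metis matrix_vector_mult_0)
  qed
qed

lemma finite_step_matrices: "finite step_matrices"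
  by (simp add: step_matrices_def)

lemma sum_step_matrices:
  fixes g :: "((real, 'd::{finite,linorder}) vec, 'd) vec \<Rightarrow> real"
  shows "sum g step_matrices =
    g 0 + (\<Sum>i<CARD('d). g (rotation i)) + (\<Sum>i<CARD('d). g (- rotation i))"
proof -
  let ?R = "rotation ` {..<CARD('d)} :: (((real, 'd) vec, 'd) vec) set"
  let ?N = "(\<lambda>i. - rotation i) ` {..<CARD('d)} :: (((real, 'd) vec, 'd) vec) set"
  have inj: "inj_on (\<lambda>i. - rotation i :: ((real, 'd) vec, 'd) vec) {..<CARD('d)}"
    using rotation_distinct(1) by (auto simp: inj_on_def)
  \<comment> \<open>Zero, the rotations and their negatives are pairwise disjoint.\<close>
  have "0 \<notin> ?R \<union> ?N" "?R \<inter> ?N = {}"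
    using rotation_distinct(2,3) by (auto simp: image_iff)
  hence "sum g step_matrices = g 0 + (sum g ?R + sum g ?N)"
    unfolding step_matrices_def by (simp add: sum.union_disjoint)
  thus ?thesis
    by (simp add: sum.reindex[OF inj] sum.reindex[OF rotation_distinct(1)])
qed

lemma rotation_mult_unit_steps:
  assumes "x \<in> unit_steps"
  shows "rotation i *v x \<in> unit_steps"
  using assms rotation_axis[of i] unfolding unit_steps_def
  by (force simp: matrix_vector_mult_uminus)

lemma step_matrices_mult:
  fixes x :: "(real, 'd::{finite,linorder}) vec"
  assumes "B \<in> step_matrices" "x \<in> insert 0 unit_steps"
  shows "B *v x \<in> insert 0 unit_steps"
proof -
  have neg: "- y \<in> unit_steps" if "y \<in> unit_steps" for y :: "(real, 'd) vec"
    using that by (auto simp: unit_steps_def)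
  show ?thesis
    using assms rotation_mult_unit_steps[of x] neg
    by (auto simp: step_matrices_def matrix_vector_mult_uminus(1))
qed

lemma norm_unit_steps: "x \<in> unit_steps \<Longrightarrow> norm x = 1"
  by (auto simp: unit_steps_def)

lemma unit_steps_component: "x \<in> insert 0 unit_steps \<Longrightarrow> x $ i \<in> {-1, 0, 1}"
  by (auto simp: unit_steps_def axis_def)

section \<open>Essentially bounded random variables\<close>

lemma (in prob_space) AE_in_finite_set:
  assumes "finite I" "\<And>v. v \<in> I \<Longrightarrow> {\<omega> \<in> space M. Y \<omega> = v} \<in> events"
    and "(\<Sum>v\<in>I. prob {\<omega> \<in> space M. Y \<omega> = v}) = 1"
  shows "AE \<omega> in M. Y \<omega> \<in> I"
proof -
  have "prob (\<Union>v\<in>I. {\<omega> \<in> space M. Y \<omega> = v}) = 1"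
    using assms by (subst finite_measure_finite_Union) (auto simp: disjoint_family_on_def)
  hence "AE \<omega> in M. \<omega> \<in> (\<Union>v\<in>I. {\<omega> \<in> space M. Y \<omega> = v})"
    by (rule AE_prob_1)
  thus ?thesis by eventually_elim auto
qed

text \<open>
  Every random variable whose expectation is needed is built from the steps and from indicators
  by arithmetic, and the steps are bounded only almost surely. This class of functions is closed under arithmetic and
  consists of integrable functions, so integrability becomes a structural check.
\<close>
definition ess_bounded :: "'a measure \<Rightarrow> ('a \<Rightarrow> real) \<Rightarrow> bool"
  where "ess_bounded M f \<longleftrightarrow> f \<in> borel_measurable M \<and> (\<exists>C. AE x in M. \<bar>f x\<bar> \<le> C)"

lemma ess_boundedI: "f \<in> borel_measurable M \<Longrightarrow> AE x in M. \<bar>f x\<bar> \<le> C \<Longrightarrow> ess_bounded M f"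
  by (auto simp: ess_bounded_def)

lemma (in finite_measure) ess_bounded_integrable: "ess_bounded M f \<Longrightarrow> integrable M f"
  unfolding ess_bounded_def by (elim conjE exE) (rule integrable_const_bound, simp_all)

lemma ess_bounded_const: "ess_bounded M (\<lambda>x. c)"
  by (rule ess_boundedI[where C = "\<bar>c\<bar>"]) auto

lemma ess_bounded_indicator: "D \<in> sets M \<Longrightarrow> ess_bounded M (indicator D)"
  by (rule ess_boundedI[where C = 1]) (auto simp: indicator_def)

lemma ess_bounded_mult:
  assumes "ess_bounded M f" "ess_bounded M g"
  shows "ess_bounded M (\<lambda>x. f x * g x)"
proof -
  obtain C D where "AE x in M. \<bar>f x\<bar> \<le> C" "AE x in M. \<bar>g x\<bar> \<le> D"
    using assms by (auto simp: ess_bounded_def)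
  hence "AE x in M. \<bar>f x * g x\<bar> \<le> C * D"
    by eventually_elim (auto simp: abs_mult intro: mult_mono)
  thus ?thesis using assms by (intro ess_boundedI) (auto simp: ess_bounded_def)
qed

lemma ess_bounded_add:
  assumes "ess_bounded M f" "ess_bounded M g"
  shows "ess_bounded M (\<lambda>x. f x + g x)"
proof -
  obtain C D where "AE x in M. \<bar>f x\<bar> \<le> C" "AE x in M. \<bar>g x\<bar> \<le> D"
    using assms by (auto simp: ess_bounded_def)
  hence "AE x in M. \<bar>f x + g x\<bar> \<le> C + D"
    by eventually_elim linarith
  thus ?thesis using assms by (intro ess_boundedI) (auto simp: ess_bounded_def)
qed

lemma ess_bounded_sum:
  "(\<And>i. i \<in> I \<Longrightarrow> ess_bounded M (f i)) \<Longrightarrow> ess_bounded M (\<lambda>x. \<Sum>i\<in>I. f i x)"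
  by (induction I rule: infinite_finite_induct)
     (auto intro: ess_bounded_const ess_bounded_add)

lemma ess_bounded_power: "ess_bounded M f \<Longrightarrow> ess_bounded M (\<lambda>x. f x ^ k)"
  by (induction k) (auto intro: ess_bounded_const ess_bounded_mult)

lemma ess_bounded_divide: "ess_bounded M f \<Longrightarrow> ess_bounded M (\<lambda>x. f x / c)"
  using ess_bounded_mult[OF _ ess_bounded_const[of M "inverse c"], of f] by (simp add: field_simps)

lemmas ess_bounded_intros = ess_bounded_const ess_bounded_indicator ess_bounded_mult
  ess_bounded_add ess_bounded_sum ess_bounded_power ess_bounded_divide

section \<open>Conditional law of the next step\<close>

context merws
begin

definition past :: "nat \<Rightarrow> 'a measure"
  where "past n = sigma (space M) (\<Union>k\<in>{1..n}. sets (vimage_algebra (space M) (X k) borel))"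

lemma space_past [simp]: "space (past n) = space M"
  by (simp add: past_def space_measure_of_conv)

lemma sets_past:
  "sets (past n) =
    sigma_sets (space M) (\<Union>k\<in>{1..n}. sets (vimage_algebra (space M) (X k) borel))"
  unfolding past_def
  by (rule sets_measure_of) (use sets.sets_into_space in fastforce)

lemma sets_past_subset: "sets (past n) \<subseteq> events"
  unfolding sets_past
proof (rule sets.sigma_sets_subset, rule UN_least)
  fix k assume "k \<in> {1..n}"
  thus "sets (vimage_algebra (space M) (X k) borel) \<subseteq> events"
    using X_rv[of k] by (auto simp: sets_vimage_algebra2 intro: measurable_sets)
qed

lemma past_mono: "m \<le> n \<Longrightarrow> sets (past m) \<subseteq> sets (past n)"
  unfolding sets_past by (rule sigma_sets_mono') fastforce

lemma measurable_past: "f \<in> borel_measurable (past n) \<Longrightarrow> f \<in> borel_measurable M"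
  using sets_past_subset by (auto simp: measurable_def)

lemma X_measurable_past:
  assumes "k \<in> {1..n}"
  shows "X k \<in> borel_measurable (past n)"
proof (rule measurableI)
  fix B :: "(real, 'd) vec set" assume "B \<in> sets borel"
  hence "X k -` B \<inter> space M \<in> sets (vimage_algebra (space M) (X k) borel)"
    by (rule in_vimage_algebra)
  thus "X k -` B \<inter> space (past n) \<in> sets (past n)"
    using assms unfolding space_past sets_past by blast
qed simp

lemma prob_step_inter_past:
  assumes n: "n \<ge> 1" and D: "D \<in> sets (past n)"
  shows "prob ({\<omega> \<in> space M. A (Suc n) \<omega> = B} \<inter> {\<omega> \<in> space M. U (Suc n) \<omega> = k} \<inter> D) =
    prob {\<omega> \<in> space M. A (Suc n) \<omega> = B} * prob {\<omega> \<in> space M. U (Suc n) \<omega> = k} * prob D"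
    (is "prob (?a \<inter> ?u \<inter> D) = _")
proof -
  have a: "?a \<in> sets (vimage_algebra (space M) (A (Suc n)) borel)"
    using in_vimage_algebra[of "{B}" borel "A (Suc n)" "space M"]
    by (simp add: vimage_def Int_def conj_commute)
  have u: "?u \<in> sets (vimage_algebra (space M) (U (Suc n)) (count_space UNIV))"
    using in_vimage_algebra[of "{k}" "count_space UNIV" "U (Suc n)" "space M"]
    by (simp add: vimage_def Int_def conj_commute)
  have three: "{..<3} = {0, 1, 2::nat}" by auto
  have "prob (\<Inter>j\<in>{..<3}. [?a, ?u, D] ! j) = (\<Prod>j\<in>{..<3}. prob ([?a, ?u, D] ! j))"
    by (rule indep_setsD[OF independence[OF n]])
       (use a u D in \<open>auto simp: three sets_past\<close>)
  thus ?thesis by (simp add: three Int_assoc mult.assoc)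
qed

text \<open>
  The choice of matrix and remembered time is independent of the past; this passes from events
  of the past to integrable functions of the past through the independence of \<open>H\<close> from the
  indicator of the choice.
\<close>
lemma expectation_step_indicator:
  fixes B :: "((real, 'd) vec, 'd) vec" and k :: nat
  assumes n: "n \<ge> 1" and H: "H \<in> borel_measurable (past n)" "integrable M H"
  defines "E \<equiv> {\<omega> \<in> space M. A (Suc n) \<omega> = B} \<inter> {\<omega> \<in> space M. U (Suc n) \<omega> = k}"
  shows "expectation (\<lambda>\<omega>. indicator E \<omega> * H \<omega>) =
    prob {\<omega> \<in> space M. A (Suc n) \<omega> = B} * prob {\<omega> \<in> space M. U (Suc n) \<omega> = k} * expectation H"
proof -
  have E: "E \<in> events"
    unfolding E_def using A_rv[OF n] U_rv[OF n] by measurable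
  have pE_eq: "prob E = prob {\<omega> \<in> space M. A (Suc n) \<omega> = B} * prob {\<omega> \<in> space M. U (Suc n) \<omega> = k}"
    using prob_step_inter_past[OF n sets.top, of B k] sets.sets_into_space[OF E]
    unfolding E_def space_past by (simp add: prob_space Int_absorb2)
  have pE: "prob (E \<inter> D) = prob E * prob D" if "D \<in> sets (past n)" for D
    using prob_step_inter_past[OF n that, of B k] unfolding pE_eq by (simp add: E_def)
  \<comment> \<open>The indicator generates only \<open>E\<close>, its complement and the trivial events.\<close>
  have pE': "prob ((space M - E) \<inter> D) = prob (space M - E) * prob D" if D: "D \<in> sets (past n)" for D
  proof -
    have D': "D \<in> events" using D sets_past_subset by blast
    have "(space M - E) \<inter> D = D - E" using sets.sets_into_space[OF D'] by blast
    moreover have "prob (D - E) = prob D - prob (D \<inter> E)"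
      by (rule finite_measure_Diff') (use D' E in auto)
    ultimately show ?thesis
      using pE[OF D] by (simp add: Int_commute algebra_simps prob_compl[OF E])
  qed
  have "indep_var borel (indicator E :: 'a \<Rightarrow> real) borel H"
    unfolding indep_var_eq
  proof (intro conjI indep_setI)
    show rv: "random_variable borel (indicator E :: 'a \<Rightarrow> real)" "random_variable borel H"
      using E H by (auto dest: measurable_past)
    show "sigma_sets (space M) {(indicator E :: 'a \<Rightarrow> real) -` T \<inter> space M |T. T \<in> sets borel} \<subseteq> events"
      "sigma_sets (space M) {H -` T \<inter> space M |T. T \<in> sets borel} \<subseteq> events"
      using rv by (auto intro!: sets.sigma_sets_subset measurable_sets)
    fix a D
    assume "a \<in> sigma_sets (space M) {(indicator E :: 'a \<Rightarrow> real) -` T \<inter> space M |T. T \<in> sets borel}"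
    then obtain T where a: "a = (indicator E :: 'a \<Rightarrow> real) -` T \<inter> space M"
      unfolding sets_vimage_algebra[symmetric] by (auto simp: sets_vimage_algebra2)
    assume "D \<in> sigma_sets (space M) {H -` T \<inter> space M |T. T \<in> sets borel}"
    then obtain T' where "T' \<in> sets borel" "D = H -` T' \<inter> space M"
      unfolding sets_vimage_algebra[symmetric] by (auto simp: sets_vimage_algebra2)
    hence D: "D \<in> sets (past n)"
      using measurable_sets[OF H(1)] by auto
    have "a = (if 1 \<in> T then E else {}) \<union> (if 0 \<in> T then space M - E else {})"
      using sets.sets_into_space[OF E] by (auto simp: a indicator_def of_bool_def split: if_splits)
    moreover have "E \<union> (space M - E) = space M"
      using sets.sets_into_space[OF E] by auto
    moreover have "space M \<inter> D = D"
      using D sets_past_subset sets.sets_into_space by blast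
    ultimately show "prob (a \<inter> D) = prob a * prob D"
      using pE[OF D] pE'[OF D] by (auto simp: prob_space)
  qed
  hence "expectation (\<lambda>\<omega>. indicator E \<omega> * H \<omega>) = expectation (indicator E) * expectation H"
    by (rule indep_var_lebesgue_integral)
      (use E H in \<open>auto intro: ess_bounded_integrable[OF ess_bounded_indicator]\<close>)
  also have "expectation (indicator E) = prob E" using E by simp
  finally show ?thesis by (simp add: pE_eq)
qed

lemma AE_U_range:
  assumes "n \<ge> 1"
  shows "AE \<omega> in M. U (Suc n) \<omega> \<in> {1..n}"
proof (rule AE_in_finite_set)
  show "{\<omega> \<in> space M. U (Suc n) \<omega> = v} \<in> events" for v
    using U_rv[OF assms] by measurable
qed (use U_uniform[OF assms] assms in auto)

lemma prob_A_rotation: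
  assumes n: "n \<ge> 1" and i: "i < CARD('d)"
  shows "prob {\<omega> \<in> space M. A (Suc n) \<omega> = rotation i} = (if i = 0 then p else q)"
    and "prob {\<omega> \<in> space M. A (Suc n) \<omega> = - rotation i} = q"
  using A_id[OF n] A_neg_id[OF n] A_cyclic[OF n, of i] A_neg_cyclic[OF n, of i] i
  by (cases "i = 0"; simp add: rotation_0; simp add: rotation_def)+

text \<open>
  All matrices other than \<open>0\<close> and the identity carry the weight \<open>q\<close>. Splitting the weight
  \<open>p\<close> of the identity as \<open>(p - q) + q\<close> leaves a sum that is symmetric under change of sign.
\<close>
lemma sum_prob_A:
  fixes g :: "((real, 'd) vec, 'd) vec \<Rightarrow> real"
  assumes n: "n \<ge> 1"
  shows "(\<Sum>B\<in>step_matrices. prob {\<omega> \<in> space M. A (Suc n) \<omega> = B} * g B) =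
    r * g 0 + (p - q) * g (mat 1) + q * (\<Sum>i<CARD('d). g (rotation i) + g (- rotation i))"
proof -
  have "(\<Sum>i<CARD('d). prob {\<omega> \<in> space M. A (Suc n) \<omega> = rotation i} * g (rotation i)) =
    (\<Sum>i<CARD('d). (if i = 0 then (p - q) * g (mat 1) else 0) + q * g (rotation i))"
    by (rule sum.cong) (auto simp: prob_A_rotation[OF n] rotation_0 algebra_simps)
  also have "\<dots> = (p - q) * g (mat 1) + q * (\<Sum>i<CARD('d). g (rotation i))"
    by (simp add: sum.distrib sum_distrib_left)
  finally show ?thesis
    by (simp add: sum_step_matrices A_zero[OF n] prob_A_rotation(2)[OF n] sum.distrib
        sum_distrib_left[symmetric] distrib_left)
qed

lemma sum_prob_A_one:
  assumes n: "n \<ge> 1"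
  shows "(\<Sum>B\<in>step_matrices. prob {\<omega> \<in> space M. A (Suc n) \<omega> = B}) = 1"
  using sum_prob_A[OF n, of "\<lambda>_. 1"] pqr_sum by (simp add: algebra_simps)

lemma AE_A_step_matrices:
  assumes n: "n \<ge> 1"
  shows "AE \<omega> in M. A (Suc n) \<omega> \<in> step_matrices"
proof (rule AE_in_finite_set[OF finite_step_matrices _ sum_prob_A_one[OF n]])
  show "{\<omega> \<in> space M. A (Suc n) \<omega> = v} \<in> events" for v
    using A_rv[OF n] by measurable
qed

lemma AE_X_1: "AE \<omega> in M. X 1 \<omega> \<in> unit_steps"
proof (rule AE_in_finite_set)
  let ?P = "\<lambda>v. prob {\<omega> \<in> space M. X 1 \<omega> = v}"
  show "{\<omega> \<in> space M. X 1 \<omega> = v} \<in> events" for v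
    using X_rv[of 1] by simp measurable
  have "inj (\<lambda>i::'d. axis i (1::real))" "inj (\<lambda>i::'d. - axis i (1::real))"
    by (auto simp: inj_def axis_eq_axis)
  hence "sum ?P (range (\<lambda>i. axis i 1)) = 1/2" "sum ?P (range (\<lambda>i. - axis i 1)) = 1/2"
    using X_1_pos X_1_neg by (simp_all add: sum.reindex)
  moreover have "range (\<lambda>i. axis i (1::real)) \<inter> range (\<lambda>i. - axis i 1) = {}"
    using axis_neq_minus_axis by auto
  ultimately show "sum ?P unit_steps = 1"
    unfolding unit_steps_def by (subst sum.union_disjoint) auto
qed (simp add: unit_steps_def)

text \<open>
  The recursion for \<open>X\<close> refers to a random earlier time, so the claim is proved by complete
  induction on one event of full measure on which all matrices and all remembered times have
  admissible values.
\<close>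
lemma AE_X_steps: "AE \<omega> in M. \<forall>n\<ge>1. X n \<omega> \<in> insert 0 unit_steps"
proof -
  have "AE \<omega> in M. \<forall>n. n \<ge> 1 \<longrightarrow> A (Suc n) \<omega> \<in> step_matrices \<and> U (Suc n) \<omega> \<in> {1..n}"
    unfolding AE_all_countable using AE_A_step_matrices AE_U_range by auto
  with AE_X_1 AE_space show ?thesis
  proof eventually_elim
    case (elim \<omega>)
    show ?case
    proof (intro allI impI)
      fix n :: nat assume "n \<ge> 1"
      thus "X n \<omega> \<in> insert 0 unit_steps"
      proof (induction n rule: less_induct)
        case (less n)
        show ?case
        proof (cases "n = 1")
          case True
          thus ?thesis using elim by auto
        next
          case False
          then obtain m where m: "n = Suc m" "m \<ge> 1"
            using less.prems by (cases n) auto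
          hence AU: "A n \<omega> \<in> step_matrices" "U n \<omega> \<in> {1..m}" using elim by auto
          hence "X (U n \<omega>) \<omega> \<in> insert 0 unit_steps" using less.IH m by auto
          thus ?thesis
            using X_step[of m \<omega>] elim m AU step_matrices_mult[of "A n \<omega>" "X (U n \<omega>) \<omega>"] by simp
        qed
      qed
    qed
  qed
qed

text \<open>
  A form of the conditional expectation of \<open>\<phi> (X (Suc n))\<close> given the past, expressed by
  integration against arbitrary bounded functions \<open>G\<close> of the past. Averaging over the remembered
  time produces the mean of \<open>\<phi>\<close> over the history, and averaging over the matrix produces the
  factor \<open>c\<close>. It is used for the coordinates, with \<open>c = p - q\<close>, and for the squared norm, with
  \<open>c = 1 - r\<close>.
\<close>
lemma expectation_next_step:
  fixes \<phi> :: "(real, 'd) vec \<Rightarrow> real"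
  assumes n: "n \<ge> 1" and G: "G \<in> borel_measurable (past n)" "ess_bounded M G"
    and \<phi>: "\<phi> \<in> borel_measurable borel"
    and bound: "\<And>x. x \<in> insert 0 unit_steps \<Longrightarrow> \<bar>\<phi> x\<bar> \<le> C"
    and mean: "\<And>x. x \<in> insert 0 unit_steps \<Longrightarrow>
      (\<Sum>B\<in>step_matrices. prob {\<omega> \<in> space M. A (Suc n) \<omega> = B} * \<phi> (B *v x)) = c * \<phi> x"
  shows "expectation (\<lambda>\<omega>. G \<omega> * \<phi> (X (Suc n) \<omega>)) =
    c / n * expectation (\<lambda>\<omega>. G \<omega> * (\<Sum>k=1..n. \<phi> (X k \<omega>)))"
proof -
  let ?E = "\<lambda>B k. {\<omega> \<in> space M. A (Suc n) \<omega> = B} \<inter> {\<omega> \<in> space M. U (Suc n) \<omega> = k}"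
  let ?P = "\<lambda>B. prob {\<omega> \<in> space M. A (Suc n) \<omega> = B}"
  let ?H = "\<lambda>B k \<omega>. G \<omega> * \<phi> (B *v X k \<omega>)"
  have E: "?E B k \<in> events" for B k
    using A_rv[OF n] U_rv[OF n] by measurable
  have mult_meas: "(\<lambda>x. B *v x) \<in> borel_measurable borel" for B :: "((real, 'd) vec, 'd) vec"
    by (intro borel_measurable_continuous_onI linear_continuous_on matrix_vector_mul_bounded_linear)
  have Hpast: "?H B k \<in> borel_measurable (past n)" if "k \<in> {1..n}" for B k
    using G(1) measurable_compose[OF X_measurable_past[OF that] measurable_compose[OF mult_meas \<phi>]]
    by (intro borel_measurable_times) auto
  have Hb: "ess_bounded M (?H B k)" if "k \<in> {1..n}" "B \<in> step_matrices" for B k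
  proof (rule ess_bounded_mult[OF G(2)], rule ess_boundedI)
    show "(\<lambda>\<omega>. \<phi> (B *v X k \<omega>)) \<in> borel_measurable M"
      using measurable_compose[OF X_rv[of k] measurable_compose[OF mult_meas \<phi>]] that by auto
    show "AE \<omega> in M. \<bar>\<phi> (B *v X k \<omega>)\<bar> \<le> C"
      using AE_X_steps by eventually_elim (use that bound step_matrices_mult in auto)
  qed
  have int: "integrable M (\<lambda>\<omega>. indicator (?E B k) \<omega> * ?H B k \<omega>)"
    if "k \<in> {1..n}" "B \<in> step_matrices" for B k
    by (intro ess_bounded_integrable ess_bounded_mult[OF ess_bounded_indicator] E Hb that)
  \<comment> \<open>Almost surely exactly one pair of a matrix and a time is chosen.\<close>
  have "AE \<omega> in M. G \<omega> * \<phi> (X (Suc n) \<omega>) =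
      (\<Sum>B\<in>step_matrices. \<Sum>k=1..n. indicator (?E B k) \<omega> * ?H B k \<omega>)"
    using AE_A_step_matrices[OF n] AE_U_range[OF n] AE_space
  proof eventually_elim
    case (elim \<omega>)
    have "(\<Sum>B\<in>step_matrices. \<Sum>k=1..n. indicator (?E B k) \<omega> * ?H B k \<omega>) =
      (\<Sum>B\<in>step_matrices. if B = A (Suc n) \<omega> then
        (\<Sum>k=1..n. if k = U (Suc n) \<omega> then ?H B k \<omega> else 0) else 0)"
      by (intro sum.cong refl) (use elim in \<open>auto simp: indicator_def intro!: sum.cong\<close>)
    also have "\<dots> = ?H (A (Suc n) \<omega>) (U (Suc n) \<omega>) \<omega>"
      using elim by (simp add: finite_step_matrices)
    finally show ?case using X_step[OF n] elim by simp
  qed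
  hence "expectation (\<lambda>\<omega>. G \<omega> * \<phi> (X (Suc n) \<omega>)) =
    expectation (\<lambda>\<omega>. \<Sum>B\<in>step_matrices. \<Sum>k=1..n. indicator (?E B k) \<omega> * ?H B k \<omega>)"
  proof (intro integral_cong_AE)
    show "(\<lambda>\<omega>. G \<omega> * \<phi> (X (Suc n) \<omega>)) \<in> borel_measurable M"
      using measurable_past[OF G(1)] measurable_compose[OF X_rv[of "Suc n"] \<phi>] by simp
    show "(\<lambda>\<omega>. \<Sum>B\<in>step_matrices. \<Sum>k=1..n. indicator (?E B k) \<omega> * ?H B k \<omega>) \<in> borel_measurable M"
      using int by (intro borel_measurable_sum) auto
  qed
  also have "\<dots> = (\<Sum>B\<in>step_matrices. \<Sum>k=1..n. ?P B * (1 / n) * expectation (?H B k))"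
  proof (subst Bochner_Integration.integral_sum)
    show "integrable M (\<lambda>\<omega>. \<Sum>k=1..n. indicator (?E B k) \<omega> * ?H B k \<omega>)"
      if "B \<in> step_matrices" for B
      using int that by (intro Bochner_Integration.integrable_sum) auto
    show "(\<Sum>B\<in>step_matrices. expectation (\<lambda>\<omega>. \<Sum>k=1..n. indicator (?E B k) \<omega> * ?H B k \<omega>)) =
      (\<Sum>B\<in>step_matrices. \<Sum>k=1..n. ?P B * (1 / n) * expectation (?H B k))"
    proof (rule sum.cong[OF refl], subst Bochner_Integration.integral_sum)
      fix B :: "((real, 'd) vec, 'd) vec" assume B: "B \<in> step_matrices"
      show "(\<Sum>k=1..n. expectation (\<lambda>\<omega>. indicator (?E B k) \<omega> * ?H B k \<omega>)) =
        (\<Sum>k=1..n. ?P B * (1 / n) * expectation (?H B k))"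
      proof (rule sum.cong[OF refl])
        fix k assume k: "k \<in> {1..n}"
        show "expectation (\<lambda>\<omega>. indicator (?E B k) \<omega> * ?H B k \<omega>) =
            ?P B * (1 / n) * expectation (?H B k)"
          using expectation_step_indicator[OF n Hpast[OF k] ess_bounded_integrable[OF Hb[OF k B]], of B k]
          unfolding U_uniform[OF n k] .
      qed
    qed (rule int)
  qed
  also have "\<dots> = (\<Sum>k=1..n. \<Sum>B\<in>step_matrices. ?P B * (1 / n) * expectation (?H B k))"
    by (rule sum.swap)
  also have "\<dots> = (\<Sum>k=1..n. c / n * expectation (\<lambda>\<omega>. G \<omega> * \<phi> (X k \<omega>)))"
  proof (rule sum.cong)
    fix k assume k: "k \<in> {1..n}"
    have "expectation (\<lambda>\<omega>. \<Sum>B\<in>step_matrices. ?P B * ?H B k \<omega>) =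
      (\<Sum>B\<in>step_matrices. ?P B * expectation (?H B k))"
    proof (subst Bochner_Integration.integral_sum)
      show "integrable M (\<lambda>\<omega>. ?P B * ?H B k \<omega>)" if "B \<in> step_matrices" for B
        using ess_bounded_integrable[OF Hb[OF k that]] by (rule integrable_mult_right)
    qed simp
    hence "(\<Sum>B\<in>step_matrices. ?P B * (1 / n) * expectation (?H B k)) =
      1 / n * expectation (\<lambda>\<omega>. \<Sum>B\<in>step_matrices. ?P B * ?H B k \<omega>)"
      by (simp only: sum_distrib_left mult_ac)
    also have "expectation (\<lambda>\<omega>. \<Sum>B\<in>step_matrices. ?P B * ?H B k \<omega>) =
      expectation (\<lambda>\<omega>. c * (G \<omega> * \<phi> (X k \<omega>)))"
    proof (rule integral_cong_AE)
      show "AE \<omega> in M. (\<Sum>B\<in>step_matrices. ?P B * ?H B k \<omega>) = c * (G \<omega> * \<phi> (X k \<omega>))"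
        using AE_X_steps
      proof eventually_elim
        case (elim \<omega>)
        have "(\<Sum>B\<in>step_matrices. ?P B * ?H B k \<omega>) =
          G \<omega> * (\<Sum>B\<in>step_matrices. ?P B * \<phi> (B *v X k \<omega>))"
          by (simp add: sum_distrib_left mult_ac)
        also have "\<dots> = G \<omega> * (c * \<phi> (X k \<omega>))"
          using mean[of "X k \<omega>"] elim k by simp
        finally show ?case by simp
      qed
      show "(\<lambda>\<omega>. \<Sum>B\<in>step_matrices. ?P B * ?H B k \<omega>) \<in> borel_measurable M"
        by (intro borel_measurable_sum borel_measurable_times[OF borel_measurable_const]
            measurable_past[OF Hpast[OF k]])
      show "(\<lambda>\<omega>. c * (G \<omega> * \<phi> (X k \<omega>))) \<in> borel_measurable M"
        using measurable_past[OF G(1)] measurable_compose[OF X_rv[of k] \<phi>] k by simp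
    qed
    finally show "(\<Sum>B\<in>step_matrices. ?P B * (1 / n) * expectation (?H B k)) =
        c / n * expectation (\<lambda>\<omega>. G \<omega> * \<phi> (X k \<omega>))" by simp
  qed simp
  also have "\<dots> = c / n * expectation (\<lambda>\<omega>. \<Sum>k=1..n. G \<omega> * \<phi> (X k \<omega>))"
  proof -
    have "integrable M (\<lambda>\<omega>. G \<omega> * \<phi> (X k \<omega>))" if "k \<in> {1..n}" for k
    proof (intro ess_bounded_integrable ess_bounded_mult[OF G(2)] ess_boundedI)
      show "(\<lambda>\<omega>. \<phi> (X k \<omega>)) \<in> borel_measurable M"
        using measurable_compose[OF X_rv[of k] \<phi>] that by simp
      show "AE \<omega> in M. \<bar>\<phi> (X k \<omega>)\<bar> \<le> C"
        using AE_X_steps by eventually_elim (use that bound in auto)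
    qed
    thus ?thesis by (simp add: Bochner_Integration.integral_sum sum_distrib_left)
  qed
  finally show ?thesis by (simp add: sum_distrib_left)
qed

end

section \<open>The critical regime\<close>

locale critical_merws = merws +
  assumes critical: "p = critical_p CARD('b) r"
begin

definition a :: real where "a = (1 - r) / 2"

lemma a_range: "0 < a" "2 * a \<le> 1"
  using r_range by (auto simp: a_def)

text \<open>
  The critical value of \<open>p\<close> is exactly the one for which \<open>p - q\<close> is half of the probability
  of not stopping.
\<close>
lemma p_minus_q: "p - q = a"
proof -
  define d where "d = real CARD('b)"
  have d: "d \<ge> 1" by (simp add: d_def Suc_leI)
  have "(2 * d - 1) * (4 * d * q) = (2 * d - 1) * (1 - r)"
    using pqr_sum critical d by (simp add: critical_p_def d_def[symmetric] field_simps)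
  hence "4 * d * q = 1 - r" using d by (subst (asm) mult_left_cancel) auto
  hence "q = (1 - r) / (4 * d)" using d by (simp add: field_simps)
  moreover have "p = (2 * d + 1) * (1 - r) / (4 * d)"
    using critical by (simp add: critical_p_def d_def)
  ultimately have "p - q = 2 * d * (1 - r) / (4 * d)"
    by (simp add: diff_divide_distrib[symmetric] algebra_simps)
  thus ?thesis using d by (simp add: a_def)
qed

text \<open>
  Nonzero steps are unit vectors, so this counts the steps among the first \<open>n\<close> that are not
  stops.
\<close>
definition moves :: "nat \<Rightarrow> 'a \<Rightarrow> real"
  where "moves n \<omega> = (\<Sum>k=1..n. (norm (X k \<omega>))\<^sup>2)"

lemma S_eq_sum:
  assumes "\<omega> \<in> space M"
  shows "S n \<omega> = (\<Sum>k=1..n. X k \<omega>)"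
proof (induction n)
  case 0
  show ?case using S_0[OF assms] by simp
next
  case (Suc n)
  show ?case
    using Suc S_step[of n \<omega>] S_1[OF assms] assms by (cases "n = 0") simp_all
qed

lemma component_measurable: "(\<lambda>x::(real,'b) vec. x $ i) \<in> borel_measurable borel"
  by (intro borel_measurable_continuous_onI continuous_intros)

lemma norm2_measurable: "(\<lambda>x::(real,'b) vec. (norm x)\<^sup>2) \<in> borel_measurable borel"
  by measurable

lemma X_ess_bounded:
  assumes "k \<ge> 1"
  shows "ess_bounded M (\<lambda>\<omega>. X k \<omega> $ i)" "ess_bounded M (\<lambda>\<omega>. (norm (X k \<omega>))\<^sup>2)"
proof -
  show "ess_bounded M (\<lambda>\<omega>. X k \<omega> $ i)"
  proof (rule ess_boundedI)
    show "(\<lambda>\<omega>. X k \<omega> $ i) \<in> borel_measurable M"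
      using measurable_compose[OF X_rv[OF assms] component_measurable] .
    show "AE \<omega> in M. \<bar>X k \<omega> $ i\<bar> \<le> 1"
      using AE_X_steps by eventually_elim (use assms unit_steps_component[of _ i] in fastforce)
  qed
  show "ess_bounded M (\<lambda>\<omega>. (norm (X k \<omega>))\<^sup>2)"
  proof (rule ess_boundedI)
    show "(\<lambda>\<omega>. (norm (X k \<omega>))\<^sup>2) \<in> borel_measurable M"
      using measurable_compose[OF X_rv[OF assms] norm2_measurable] .
    show "AE \<omega> in M. \<bar>(norm (X k \<omega>))\<^sup>2\<bar> \<le> 1"
      using AE_X_steps by eventually_elim (use assms norm_unit_steps in fastforce)
  qed
qed

lemma S_measurable_past: "(\<lambda>\<omega>. S n \<omega> $ i) \<in> borel_measurable (past n)"
proof -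
  have "(\<lambda>\<omega>. \<Sum>k=1..n. X k \<omega> $ i) \<in> borel_measurable (past n)"
    using measurable_compose[OF X_measurable_past component_measurable]
    by (intro borel_measurable_sum) auto
  thus ?thesis
    by (subst measurable_cong[where g = "\<lambda>\<omega>. \<Sum>k=1..n. X k \<omega> $ i"]) (simp_all add: S_eq_sum)
qed

lemma S_ess_bounded: "ess_bounded M (\<lambda>\<omega>. S n \<omega> $ i)"
proof -
  have "ess_bounded M (\<lambda>\<omega>. \<Sum>k=1..n. X k \<omega> $ i)"
    by (intro ess_bounded_sum X_ess_bounded) auto
  then obtain C where "AE \<omega> in M. \<bar>\<Sum>k=1..n. X k \<omega> $ i\<bar> \<le> C"
    by (auto simp: ess_bounded_def)
  with AE_space have "AE \<omega> in M. \<bar>S n \<omega> $ i\<bar> \<le> C"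
    by eventually_elim (simp add: S_eq_sum)
  thus ?thesis by (rule ess_boundedI[OF measurable_past[OF S_measurable_past]])
qed

lemma moves_measurable_past: "moves n \<in> borel_measurable (past n)"
  unfolding moves_def[abs_def]
  using measurable_compose[OF X_measurable_past norm2_measurable]
  by (intro borel_measurable_sum) auto

lemma moves_ess_bounded: "ess_bounded M (moves n)"
  unfolding moves_def[abs_def] by (intro ess_bounded_sum X_ess_bounded) auto

lemma moves_Suc: "moves (Suc n) \<omega> = moves n \<omega> + (norm (X (Suc n) \<omega>))\<^sup>2"
  by (simp add: moves_def)

lemma moves_nonneg: "moves n \<omega> \<ge> 0"
  by (simp add: moves_def sum_nonneg)

lemmas integrable_intros = ess_bounded_integrable ess_bounded_intros
  S_ess_bounded moves_ess_bounded X_ess_bounded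

lemma drift_component:
  assumes n: "n \<ge> 1" and G: "G \<in> borel_measurable (past n)" "ess_bounded M G"
  shows "expectation (\<lambda>\<omega>. G \<omega> * X (Suc n) \<omega> $ i) = a / n * expectation (\<lambda>\<omega>. G \<omega> * S n \<omega> $ i)"
proof -
  have "expectation (\<lambda>\<omega>. G \<omega> * X (Suc n) \<omega> $ i) =
    a / n * expectation (\<lambda>\<omega>. G \<omega> * (\<Sum>k=1..n. X k \<omega> $ i))"
  proof (rule expectation_next_step[OF n G component_measurable])
    show "\<bar>x $ i\<bar> \<le> 1" if "x \<in> insert 0 unit_steps" for x :: "(real, 'b) vec"
      using unit_steps_component[OF that, of i] by auto
    show "(\<Sum>B\<in>step_matrices. prob {\<omega> \<in> space M. A (Suc n) \<omega> = B} * (B *v x) $ i) = a * x $ i"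
      for x :: "(real, 'b) vec"
      using sum_prob_A[OF n, of "\<lambda>B. (B *v x) $ i"]
      by (simp add: matrix_vector_mult_uminus p_minus_q)
  qed
  also have "expectation (\<lambda>\<omega>. G \<omega> * (\<Sum>k=1..n. X k \<omega> $ i)) = expectation (\<lambda>\<omega>. G \<omega> * S n \<omega> $ i)"
    by (rule Bochner_Integration.integral_cong) (simp_all add: S_eq_sum)
  finally show ?thesis .
qed

lemma drift_norm2:
  assumes n: "n \<ge> 1" and G: "G \<in> borel_measurable (past n)" "ess_bounded M G"
  shows "expectation (\<lambda>\<omega>. G \<omega> * (norm (X (Suc n) \<omega>))\<^sup>2) =
    2 * a / n * expectation (\<lambda>\<omega>. G \<omega> * moves n \<omega>)"
  unfolding moves_def
proof (rule expectation_next_step[OF n G norm2_measurable])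
  show "\<bar>(norm x)\<^sup>2\<bar> \<le> 1" if "x \<in> insert 0 unit_steps" for x :: "(real, 'b) vec"
    using that norm_unit_steps[of x] by auto
  show "(\<Sum>B\<in>step_matrices. prob {\<omega> \<in> space M. A (Suc n) \<omega> = B} * (norm (B *v x))\<^sup>2) =
    2 * a * (norm x)\<^sup>2" if x: "x \<in> insert 0 unit_steps" for x :: "(real, 'b) vec"
  proof (cases "x = 0")
    case False
    hence x: "x \<in> unit_steps" using x by simp
    have "norm (rotation i *v x) = 1" for i
      using rotation_mult_unit_steps[OF x] by (rule norm_unit_steps)
    thus ?thesis
      using sum_prob_A[OF n, of "\<lambda>B. (norm (B *v x))\<^sup>2"] norm_unit_steps[OF x] pqr_sum
      by (simp add: matrix_vector_mult_uminus a_def algebra_simps)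
  qed simp
qed

section \<open>Moments\<close>

text \<open>
  The mean growth of a process with drift \<open>a / n\<close> times its value. For \<open>n \<ge> 1\<close> this is
  \<open>Gamma (n + a) / (Gamma n * Gamma (1 + a))\<close>, asymptotically a constant times
  \<open>n powr a\<close>.
\<close>
definition growth :: "nat \<Rightarrow> real"
  where "growth n = (\<Prod>k=1..<n. 1 + a / real k)"

lemma growth_1: "growth (Suc 0) = 1"
  by (simp add: growth_def)

lemma growth_Suc: "n \<ge> 1 \<Longrightarrow> growth (Suc n) = growth n * (1 + a / n)"
  by (simp add: growth_def)

lemma growth_ge_1: "growth n \<ge> 1"
  unfolding growth_def by (rule prod_ge_1) (use a_range in auto)

lemma ln_Suc_diff: "n \<ge> 1 \<Longrightarrow> 1 / (real n + 1) \<le> ln (real n + 1) - ln (real n)"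
  using ln_le_minus_one[of "real n / (real n + 1)"] by (simp add: ln_div field_simps)

text \<open>
  Compare \<open>1 + a / k\<close> with \<open>exp (a / k)\<close>. The harmonic sums up to \<open>n\<close> exceed \<open>ln n\<close> by at
  most one, which costs the factor \<open>exp a\<close>.
\<close>
lemma growth_upper:
  assumes "n \<ge> 1"
  shows "growth n \<le> exp a * n powr a"
proof -
  have "growth (Suc n) \<le> exp (a * (1 + ln n))"
    using assms
  proof (induction n rule: nat_induct_at_least)
    case base
    show ?case by (simp add: growth_Suc growth_1 exp_ge_add_one_self)
  next
    case (Suc n)
    have "growth (Suc (Suc n)) = growth (Suc n) * (1 + a / (real n + 1))"
      using growth_Suc[of "Suc n"] by (simp add: add.commute)
    also have "\<dots> \<le> exp (a * (1 + ln n)) * exp (a / (real n + 1))"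
      using Suc.IH a_range by (intro mult_mono) (auto simp: exp_ge_add_one_self)
    also have "\<dots> = exp (a * (1 + ln n + 1 / (real n + 1)))"
      by (simp add: exp_add[symmetric] algebra_simps)
    also have "\<dots> \<le> exp (a * (1 + ln (Suc n)))"
      using ln_Suc_diff[OF Suc.hyps] a_range by (auto intro!: mult_left_mono simp: add.commute)
    finally show ?case .
  qed
  moreover have "growth n * 1 \<le> growth n * (1 + a / n)"
    using growth_ge_1[of n] a_range by (intro mult_left_mono) auto
  ultimately show ?thesis
    using assms by (simp add: growth_Suc powr_def exp_add distrib_left)
qed

text \<open>
  The drift of \<open>moves\<close> is twice that of the walk, and
  \<open>1 + 2 * a / n \<le> (1 + a / n)^2\<close>.
\<close>
lemma expectation_moves: "n \<ge> 1 \<Longrightarrow> expectation (moves n) \<le> growth n ^ 2"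
proof (induction n rule: nat_induct_at_least)
  case base
  have "expectation (moves 1) \<le> expectation (\<lambda>_. 1)"
  proof (rule integral_mono_AE)
    show "AE \<omega> in M. moves 1 \<omega> \<le> 1"
      using AE_X_1 by eventually_elim (simp add: moves_def norm_unit_steps)
  qed (intro integrable_intros)+
  thus ?case by (simp add: growth_1 prob_space)
next
  case (Suc n)
  have "expectation (moves (Suc n)) = expectation (\<lambda>\<omega>. moves n \<omega> + 1 * (norm (X (Suc n) \<omega>))\<^sup>2)"
    by (simp add: moves_Suc[abs_def])
  also have "\<dots> = expectation (moves n) + expectation (\<lambda>\<omega>. 1 * (norm (X (Suc n) \<omega>))\<^sup>2)"
    by (rule Bochner_Integration.integral_add) (intro integrable_intros; simp)+
  also have "\<dots> = (1 + 2 * a / n) * expectation (moves n)"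
    using Suc.hyps by (subst drift_norm2) (auto intro: ess_bounded_const simp: algebra_simps)
  also have "\<dots> \<le> (1 + a / n)\<^sup>2 * growth n ^ 2"
  proof (intro mult_mono)
    show "1 + 2 * a / n \<le> (1 + a / n)\<^sup>2" by (simp add: power2_eq_square algebra_simps)
    show "0 \<le> expectation (moves n)"
      by (intro Bochner_Integration.integral_nonneg moves_nonneg)
  qed (use Suc.IH in auto)
  finally show ?case using Suc.hyps by (simp add: growth_Suc power_mult_distrib mult.commute)
qed

text \<open>
  Since a step adds either \<open>0\<close> or \<open>1\<close> to \<open>moves\<close>, the rising product
  \<open>(moves + 1) * moves\<close> satisfies an exact linear recursion with factor \<open>1 + 4 * a / n\<close>, which
  the plain second moment does not.
\<close>
lemma expectation_moves_sq: "n \<ge> 1 \<Longrightarrow> expectation (\<lambda>\<omega>. (moves n \<omega> + 1) * moves n \<omega>) \<le> 2 * growth n ^ 4"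
proof (induction n rule: nat_induct_at_least)
  case base
  have "expectation (\<lambda>\<omega>. (moves 1 \<omega> + 1) * moves 1 \<omega>) \<le> expectation (\<lambda>_. 2)"
  proof (rule integral_mono_AE)
    show "AE \<omega> in M. (moves 1 \<omega> + 1) * moves 1 \<omega> \<le> 2"
      using AE_X_1 by eventually_elim (simp add: moves_def norm_unit_steps)
  qed (intro integrable_intros)+
  thus ?case by (simp add: growth_1 prob_space)
next
  case (Suc n)
  let ?y = "\<lambda>\<omega>. (norm (X (Suc n) \<omega>))\<^sup>2"
  have "expectation (\<lambda>\<omega>. (moves (Suc n) \<omega> + 1) * moves (Suc n) \<omega>) =
    expectation (\<lambda>\<omega>. (moves n \<omega> + 1) * moves n \<omega> + 2 * ((moves n \<omega> + 1) * ?y \<omega>))"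
  proof (rule integral_cong_AE)
    show "AE \<omega> in M. (moves (Suc n) \<omega> + 1) * moves (Suc n) \<omega> = (moves n \<omega> + 1) * moves n \<omega> + 2 * ((moves n \<omega> + 1) * ?y \<omega>)"
      using AE_X_steps
    proof eventually_elim
      case (elim \<omega>)
      hence "X (Suc n) \<omega> \<in> insert 0 unit_steps" by simp
      hence "?y \<omega> = 0 \<or> ?y \<omega> = 1" using norm_unit_steps[of "X (Suc n) \<omega>"] by auto
      thus ?case by (elim disjE) (simp_all add: moves_Suc algebra_simps)
    qed
  qed (intro borel_measurable_integrable integrable_intros; simp)+
  also have "\<dots> = expectation (\<lambda>\<omega>. (moves n \<omega> + 1) * moves n \<omega>) + 2 * expectation (\<lambda>\<omega>. (moves n \<omega> + 1) * ?y \<omega>)"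
    by (subst Bochner_Integration.integral_add) ((intro integrable_intros; simp)+, simp)
  also have "\<dots> = (1 + 4 * a / n) * expectation (\<lambda>\<omega>. (moves n \<omega> + 1) * moves n \<omega>)"
    using Suc.hyps
    by (subst drift_norm2)
       (auto intro!: borel_measurable_add moves_measurable_past integrable_intros simp: algebra_simps)
  also have "\<dots> \<le> (1 + a / n) ^ 4 * (2 * growth n ^ 4)"
  proof (intro mult_mono)
    show "1 + 4 * a / n \<le> (1 + a / n) ^ 4"
      using Bernoulli_inequality[of "a / n" 4] a_range by (simp add: order_trans[of _ 0])
    show "0 \<le> expectation (\<lambda>\<omega>. (moves n \<omega> + 1) * moves n \<omega>)"
      by (intro Bochner_Integration.integral_nonneg mult_nonneg_nonneg add_nonneg_nonneg moves_nonneg) auto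
  qed (use Suc.IH in auto)
  finally show ?case using Suc.hyps by (simp add: growth_Suc power_mult_distrib mult_ac)
qed

text \<open>
  Expand the fourth power of \<open>s + x\<close>, where \<open>s\<close> is a coordinate of the walk and \<open>x\<close> that of the
  new step, using \<open>x^3 = x\<close>. The terms odd in \<open>x\<close> contribute the drift, which is absorbed by the
  growth factor. The main remaining term is \<open>s^2 * moves\<close>. Weighted arithmetic-geometric means
  bound it by \<open>s^4\<close> and \<open>moves^2\<close>, that is, up to a constant, by the square root
  \<open>c * (growth n)^2\<close> of the inductive bound times \<open>(growth n)^2\<close>. After division by the fourth power of \<open>growth\<close> the moment therefore
  increases by at most \<open>12 * c / n\<close> per step, and \<open>c = 12 * (1 + ln n)\<close> is chosen so that \<open>c^2\<close>
  increases by at least that much.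
\<close>
lemma expectation_S4:
  "n \<ge> 1 \<Longrightarrow> expectation (\<lambda>\<omega>. (S n \<omega> $ i) ^ 4) \<le> (12 * (1 + ln n))\<^sup>2 * growth n ^ 4"
proof (induction n rule: nat_induct_at_least)
  case base
  have "expectation (\<lambda>\<omega>. (S 1 \<omega> $ i) ^ 4) \<le> expectation (\<lambda>_. 1)"
  proof (rule integral_mono_AE)
    show "AE \<omega> in M. (S 1 \<omega> $ i) ^ 4 \<le> 1"
      using AE_X_1 AE_space
    proof eventually_elim
      case (elim \<omega>)
      thus ?case using unit_steps_component[of "X 1 \<omega>" i] S_1[of \<omega>] by auto
    qed
  qed (intro integrable_intros)+
  thus ?case by (simp add: growth_1 prob_space)
next
  case (Suc n)
  let ?s = "\<lambda>\<omega>. S n \<omega> $ i" and ?x = "\<lambda>\<omega>. X (Suc n) \<omega> $ i"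
  let ?y = "\<lambda>\<omega>. (norm (X (Suc n) \<omega>))\<^sup>2"
  let ?g = "growth n"
  define c where "c = 12 * (1 + ln (real n))"
  have c: "c \<ge> 12" using Suc.hyps by (simp add: c_def)
  have g: "?g \<ge> 1" "?g ^ 2 \<le> ?g ^ 4" "1 \<le> ?g ^ 4"
    using growth_ge_1[of n] by (auto intro: power_increasing one_le_power)
  have IH: "expectation (\<lambda>\<omega>. ?s \<omega> ^ 4) \<le> c\<^sup>2 * ?g ^ 4"
    using Suc.IH by (simp add: c_def)
  \<comment> \<open>Since \<open>c \<ge> 12\<close>, the term \<open>c * ?g ^ 4\<close> also dominates the lower order terms.\<close>
  have EQ: "expectation (moves n) \<le> c * ?g ^ 4"
  proof -
    have "expectation (moves n) \<le> 1 * ?g ^ 4" using expectation_moves[OF Suc.hyps] g by linarith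
    also have "\<dots> \<le> c * ?g ^ 4" using c g by (intro mult_right_mono) auto
    finally show ?thesis .
  qed
  have ES2: "expectation (\<lambda>\<omega>. ?s \<omega> ^ 2) \<le> c * ?g ^ 4"
  proof -
    have "expectation (\<lambda>\<omega>. ?s \<omega> ^ 2) \<le> expectation (\<lambda>\<omega>. ?s \<omega> ^ 4 / (2 * c) + c / 2)"
    proof (rule integral_mono)
      fix \<omega>
      have "0 \<le> (?s \<omega> ^ 2 - c)\<^sup>2" by simp
      hence "2 * c * ?s \<omega> ^ 2 \<le> ?s \<omega> ^ 4 + c\<^sup>2"
        by (simp add: power2_eq_square power4_eq_xxxx algebra_simps)
      thus "?s \<omega> ^ 2 \<le> ?s \<omega> ^ 4 / (2 * c) + c / 2"
        using c by (simp add: field_simps power2_eq_square)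
    qed (intro integrable_intros)+
    also have "\<dots> = expectation (\<lambda>\<omega>. ?s \<omega> ^ 4) / (2 * c) + c / 2"
      by (subst Bochner_Integration.integral_add) ((intro integrable_intros)+, simp add: prob_space)
    also have "\<dots> \<le> c\<^sup>2 * ?g ^ 4 / (2 * c) + c * ?g ^ 4 / 2"
      using IH c g by (intro add_mono divide_right_mono) auto
    finally show ?thesis using c by (simp add: power2_eq_square)
  qed
  have ES2moves: "expectation (\<lambda>\<omega>. ?s \<omega> ^ 2 * moves n \<omega>) \<le> 3 / 2 * (c * ?g ^ 4)"
  proof -
    have "expectation (\<lambda>\<omega>. ?s \<omega> ^ 2 * moves n \<omega>) \<le>
      expectation (\<lambda>\<omega>. ?s \<omega> ^ 4 / (2 * c) + c / 2 * ((moves n \<omega> + 1) * moves n \<omega>))"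
    proof (rule integral_mono)
      fix \<omega>
      \<comment> \<open>The weight \<open>c\<close> balances the bounds for the moments of \<open>s^4\<close> and of \<open>moves^2\<close>.\<close>
      have "0 \<le> (?s \<omega> ^ 2 - c * moves n \<omega>)\<^sup>2" by simp
      hence "2 * c * (?s \<omega> ^ 2 * moves n \<omega>) \<le> ?s \<omega> ^ 4 + c\<^sup>2 * moves n \<omega> ^ 2"
        by (simp add: power2_eq_square power4_eq_xxxx algebra_simps)
      also have "\<dots> \<le> ?s \<omega> ^ 4 + c\<^sup>2 * ((moves n \<omega> + 1) * moves n \<omega>)"
        using moves_nonneg[of n \<omega>] by (intro add_left_mono mult_left_mono) (auto simp: power2_eq_square algebra_simps)
      finally show "?s \<omega> ^ 2 * moves n \<omega> \<le> ?s \<omega> ^ 4 / (2 * c) + c / 2 * ((moves n \<omega> + 1) * moves n \<omega>)"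
        using c by (simp add: field_simps power2_eq_square)
    qed (intro integrable_intros)+
    also have "\<dots> = expectation (\<lambda>\<omega>. ?s \<omega> ^ 4) / (2 * c) + c / 2 * expectation (\<lambda>\<omega>. (moves n \<omega> + 1) * moves n \<omega>)"
      by (subst Bochner_Integration.integral_add) ((intro integrable_intros)+, simp)
    also have "\<dots> \<le> c\<^sup>2 * ?g ^ 4 / (2 * c) + c / 2 * (2 * ?g ^ 4)"
      using IH c expectation_moves_sq[OF Suc.hyps]
      by (intro add_mono divide_right_mono mult_left_mono) auto
    finally show ?thesis using c by (simp add: power2_eq_square field_simps)
  qed
  have "expectation (\<lambda>\<omega>. (S (Suc n) \<omega> $ i) ^ 4) \<le>
    expectation (\<lambda>\<omega>. ?s \<omega> ^ 4 + ((4 * ?s \<omega> ^ 3 + 4 * ?s \<omega>) * ?x \<omega> + (6 * ?s \<omega> ^ 2 + 1) * ?y \<omega>))"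
  proof (rule integral_mono_AE)
    show "AE \<omega> in M. (S (Suc n) \<omega> $ i) ^ 4 \<le>
        ?s \<omega> ^ 4 + ((4 * ?s \<omega> ^ 3 + 4 * ?s \<omega>) * ?x \<omega> + (6 * ?s \<omega> ^ 2 + 1) * ?y \<omega>)"
      using AE_X_steps AE_space
    proof eventually_elim
      case (elim \<omega>)
      hence x: "?x \<omega> \<in> {-1, 0, 1}" by (intro unit_steps_component) auto
      have xy: "?x \<omega> ^ 2 \<le> ?y \<omega>"
        using power_mono[OF component_le_norm_cart[of "X (Suc n) \<omega>" i], of 2] by simp
      have "S (Suc n) \<omega> $ i = ?s \<omega> + ?x \<omega>" using S_step[OF Suc.hyps] elim by simp
      moreover have "(?s \<omega> + ?x \<omega>) ^ 4 =
        ?s \<omega> ^ 4 + ((4 * ?s \<omega> ^ 3 + 4 * ?s \<omega>) * ?x \<omega> + (6 * ?s \<omega> ^ 2 + 1) * ?x \<omega> ^ 2)"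
        using x by (auto simp: power2_eq_square power3_eq_cube power4_eq_xxxx algebra_simps)
      moreover have "(6 * ?s \<omega> ^ 2 + 1) * ?x \<omega> ^ 2 \<le> (6 * ?s \<omega> ^ 2 + 1) * ?y \<omega>"
        using xy by (intro mult_left_mono) auto
      ultimately show ?case by simp
    qed
  qed (intro integrable_intros; simp)+
  also have "\<dots> = expectation (\<lambda>\<omega>. ?s \<omega> ^ 4) +
      (expectation (\<lambda>\<omega>. (4 * ?s \<omega> ^ 3 + 4 * ?s \<omega>) * ?x \<omega>) + expectation (\<lambda>\<omega>. (6 * ?s \<omega> ^ 2 + 1) * ?y \<omega>))"
    by (subst Bochner_Integration.integral_add, (intro integrable_intros; simp)+)+ simp
  also have "expectation (\<lambda>\<omega>. (4 * ?s \<omega> ^ 3 + 4 * ?s \<omega>) * ?x \<omega>) =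
      a / n * expectation (\<lambda>\<omega>. (4 * ?s \<omega> ^ 3 + 4 * ?s \<omega>) * ?s \<omega>)"
    by (rule drift_component[OF Suc.hyps])
       (intro borel_measurable_add borel_measurable_times borel_measurable_power
          borel_measurable_const S_measurable_past integrable_intros)+
  also have "expectation (\<lambda>\<omega>. (4 * ?s \<omega> ^ 3 + 4 * ?s \<omega>) * ?s \<omega>) =
      expectation (\<lambda>\<omega>. 4 * ?s \<omega> ^ 4 + 4 * ?s \<omega> ^ 2)"
    by (simp add: algebra_simps power2_eq_square power3_eq_cube power4_eq_xxxx)
  also have "\<dots> = 4 * expectation (\<lambda>\<omega>. ?s \<omega> ^ 4) + 4 * expectation (\<lambda>\<omega>. ?s \<omega> ^ 2)"
    by (subst Bochner_Integration.integral_add) ((intro integrable_intros)+, simp)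
  also have "expectation (\<lambda>\<omega>. (6 * ?s \<omega> ^ 2 + 1) * ?y \<omega>) =
      2 * a / n * expectation (\<lambda>\<omega>. (6 * ?s \<omega> ^ 2 + 1) * moves n \<omega>)"
    by (rule drift_norm2[OF Suc.hyps])
       (intro borel_measurable_add borel_measurable_times borel_measurable_power
          borel_measurable_const S_measurable_past integrable_intros)+
  also have "expectation (\<lambda>\<omega>. (6 * ?s \<omega> ^ 2 + 1) * moves n \<omega>) =
      expectation (\<lambda>\<omega>. 6 * (?s \<omega> ^ 2 * moves n \<omega>) + moves n \<omega>)"
    by (simp add: algebra_simps)
  also have "\<dots> = 6 * expectation (\<lambda>\<omega>. ?s \<omega> ^ 2 * moves n \<omega>) + expectation (moves n)"
    by (subst Bochner_Integration.integral_add) ((intro integrable_intros)+, simp)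
  also have "expectation (\<lambda>\<omega>. ?s \<omega> ^ 4) +
      (a / n * (4 * expectation (\<lambda>\<omega>. ?s \<omega> ^ 4) + 4 * expectation (\<lambda>\<omega>. ?s \<omega> ^ 2)) +
       2 * a / n * (6 * expectation (\<lambda>\<omega>. ?s \<omega> ^ 2 * moves n \<omega>) + expectation (moves n)))
    \<le> c\<^sup>2 * ?g ^ 4 + (a / n * (4 * (c\<^sup>2 * ?g ^ 4) + 4 * (c * ?g ^ 4)) +
       2 * a / n * (6 * (3 / 2 * (c * ?g ^ 4)) + c * ?g ^ 4))"
    using a_range by (intro add_mono mult_left_mono IH ES2 ES2moves EQ) auto
  also have "\<dots> = (1 + 4 * (a / n)) * (c\<^sup>2 * ?g ^ 4) + (12 * (2 * a) / n) * (c * ?g ^ 4)"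
    by (simp add: algebra_simps)
  also have "\<dots> \<le> (1 + 4 * (a / n)) * (c\<^sup>2 * ?g ^ 4) + ((1 + 4 * (a / n)) * 12 / n) * (c * ?g ^ 4)"
  proof (intro add_left_mono mult_right_mono divide_right_mono)
    show "12 * (2 * a) \<le> (1 + 4 * (a / n)) * 12"
      using a_range by simp (smt (verit) divide_nonneg_nonneg of_nat_0_le_iff)
  qed (use c g in auto)
  also have "\<dots> = (1 + 4 * (a / n)) * ((c\<^sup>2 + 12 * c / n) * ?g ^ 4)"
    by (simp add: algebra_simps add_divide_distrib)
  also have "\<dots> \<le> (1 + a / n) ^ 4 * ((12 * (1 + ln (Suc n)))\<^sup>2 * ?g ^ 4)"
  proof (intro mult_mono)
    show "1 + 4 * (a / n) \<le> (1 + a / n) ^ 4"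
      using Bernoulli_inequality[of "a / n" 4] a_range by (simp add: order_trans[of _ 0])
    \<comment> \<open>The logarithm grows by at least \<open>1 / (n + 1)\<close>, which is at least \<open>1 / (2 * n)\<close>.\<close>
    have "12 / (2 * real n) \<le> 12 / (real n + 1)"
      using Suc.hyps by (intro divide_left_mono) auto
    hence "c + 12 / (2 * real n) \<le> 12 * (1 + ln (Suc n))"
      using ln_Suc_diff[OF Suc.hyps] by (simp add: c_def add.commute)
    moreover have "c\<^sup>2 + 12 * c / n \<le> (c + 12 / (2 * real n))\<^sup>2"
      by (simp add: power2_eq_square algebra_simps)
    ultimately show "c\<^sup>2 + 12 * c / n \<le> (12 * (1 + ln (Suc n)))\<^sup>2"
      using c by (meson order_trans power_mono add_nonneg_nonneg divide_nonneg_nonneg of_nat_0_le_iff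
          mult_nonneg_nonneg zero_le_numeral)
  qed (use c g a_range in \<open>auto intro!: mult_nonneg_nonneg add_nonneg_nonneg\<close>)
  finally show ?case using Suc.hyps by (simp add: growth_Suc power_mult_distrib mult_ac)
qed

section \<open>Maximal inequality\<close>

text \<open>
  Fourth power of the martingale obtained from a coordinate of the walk.
\<close>
definition quartic :: "'b \<Rightarrow> nat \<Rightarrow> 'a \<Rightarrow> real"
  where "quartic i n \<omega> = (S n \<omega> $ i / growth n) ^ 4"

lemma quartic_measurable_past: "quartic i n \<in> borel_measurable (past n)"
  unfolding quartic_def[abs_def]
  by (intro borel_measurable_power borel_measurable_divide S_measurable_past borel_measurable_const)

lemma quartic_ess_bounded: "ess_bounded M (quartic i n)"
  unfolding quartic_def[abs_def] by (intro ess_bounded_intros S_ess_bounded)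

lemma quartic_nonneg: "quartic i n \<omega> \<ge> 0"
  by (simp add: quartic_def)

lemma expectation_quartic: "n \<ge> 1 \<Longrightarrow> expectation (quartic i n) \<le> (12 * (1 + ln n))\<^sup>2"
  using expectation_S4[of n i] growth_ge_1[of n]
  by (simp add: quartic_def[abs_def] power_divide divide_le_eq)

lemma fourth_power_tangent: "(x::real) ^ 4 + 4 * x ^ 3 * (y - x) \<le> y ^ 4"
proof -
  have "y ^ 4 - x ^ 4 - 4 * x ^ 3 * (y - x) = (y - x)\<^sup>2 * ((y + x)\<^sup>2 + 2 * x\<^sup>2)"
    by (simp add: power2_eq_square power3_eq_cube power4_eq_xxxx algebra_simps)
  moreover have "\<dots> \<ge> 0" by simp
  ultimately show ?thesis by linarith
qed

text \<open>
  The tangent to the fourth power at the present value of the martingale lies below the graph,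
  and its linear term integrates to zero over every event of the past because the drift of the
  walk is compensated by \<open>growth\<close>.
\<close>
lemma quartic_submartingale:
  assumes n: "n \<ge> 1" and D: "D \<in> sets (past n)"
  shows "expectation (\<lambda>\<omega>. indicator D \<omega> * quartic i n \<omega>) \<le>
    expectation (\<lambda>\<omega>. indicator D \<omega> * quartic i (Suc n) \<omega>)"
proof -
  let ?s = "\<lambda>\<omega>. S n \<omega> $ i" and ?x = "\<lambda>\<omega>. X (Suc n) \<omega> $ i"
  let ?g = "growth n" and ?h = "growth (Suc n)"
  let ?G = "\<lambda>\<omega>. indicator D \<omega> * (?s \<omega> / ?g) ^ 3"
  have D': "D \<in> events" using D sets_past_subset by blast
  have gh: "?h = ?g * (1 + a / n)" "?g > 0" "?h > 0"
    using growth_Suc[OF n] growth_ge_1[of n] growth_ge_1[of "Suc n"] by auto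
  have Gb: "ess_bounded M ?G"
    by (intro integrable_intros D')
  have "expectation (\<lambda>\<omega>. ?G \<omega> * ?x \<omega>) = a / n * expectation (\<lambda>\<omega>. ?G \<omega> * ?s \<omega>)"
    by (rule drift_component[OF n _ Gb])
       (intro borel_measurable_times borel_measurable_indicator D borel_measurable_power
          borel_measurable_divide S_measurable_past borel_measurable_const)
  \<comment> \<open>The left-hand side is the integral over \<open>D\<close> of the cube of the martingale times its increment.\<close>
  hence "expectation (\<lambda>\<omega>. ?G \<omega> * ?x \<omega>) / ?h + (1 / ?h - 1 / ?g) * expectation (\<lambda>\<omega>. ?G \<omega> * ?s \<omega>) =
      expectation (\<lambda>\<omega>. ?G \<omega> * ?s \<omega>) * ((1 + a / n) / ?h - 1 / ?g)"
    by (simp add: algebra_simps add_divide_distrib)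
  also have "\<dots> = 0"
  proof -
    have "1 + a / n > 0" using a_range by (intro add_pos_nonneg) auto
    thus ?thesis using gh by simp
  qed
  finally have zero: "expectation (\<lambda>\<omega>. ?G \<omega> * ?x \<omega>) / ?h +
    (1 / ?h - 1 / ?g) * expectation (\<lambda>\<omega>. ?G \<omega> * ?s \<omega>) = 0" .
  have "expectation (\<lambda>\<omega>. indicator D \<omega> * quartic i n \<omega>) =
    expectation (\<lambda>\<omega>. indicator D \<omega> * quartic i n \<omega>) + 4 * (expectation (\<lambda>\<omega>. ?G \<omega> * ?x \<omega>) / ?h +
    (1 / ?h - 1 / ?g) * expectation (\<lambda>\<omega>. ?G \<omega> * ?s \<omega>))"
    unfolding zero by simp
  also have "\<dots> = expectation (\<lambda>\<omega>. indicator D \<omega> * quartic i n \<omega> +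
      4 * (?G \<omega> * ?x \<omega> / ?h + (1 / ?h - 1 / ?g) * (?G \<omega> * ?s \<omega>)))"
  proof -
    have int: "integrable M (\<lambda>\<omega>. indicator D \<omega> * quartic i n \<omega>)" "integrable M (\<lambda>\<omega>. ?G \<omega> * ?x \<omega>)"
      "integrable M (\<lambda>\<omega>. ?G \<omega> * ?s \<omega>)"
      by (intro integrable_intros D' quartic_ess_bounded; simp)+
    show ?thesis using int by simp
  qed
  also have "\<dots> \<le> expectation (\<lambda>\<omega>. indicator D \<omega> * quartic i (Suc n) \<omega>)"
  proof (rule integral_mono)
    fix \<omega> assume "\<omega> \<in> space M"
    hence "S (Suc n) \<omega> $ i = ?s \<omega> + ?x \<omega>" using S_step[OF n] by simp
    hence "(?s \<omega> / ?g) ^ 4 + 4 * (?s \<omega> / ?g) ^ 3 * ((?s \<omega> + ?x \<omega>) / ?h - ?s \<omega> / ?g) \<le> quartic i (Suc n) \<omega>"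
      using fourth_power_tangent[of "?s \<omega> / ?g" "(?s \<omega> + ?x \<omega>) / ?h"] by (simp add: quartic_def)
    hence "indicator D \<omega> * ((?s \<omega> / ?g) ^ 4 + 4 * (?s \<omega> / ?g) ^ 3 * ((?s \<omega> + ?x \<omega>) / ?h - ?s \<omega> / ?g))
      \<le> indicator D \<omega> * quartic i (Suc n) \<omega>" by (intro mult_left_mono) auto
    thus "indicator D \<omega> * quartic i n \<omega> + 4 * (?G \<omega> * ?x \<omega> / ?h + (1 / ?h - 1 / ?g) * (?G \<omega> * ?s \<omega>))
      \<le> indicator D \<omega> * quartic i (Suc n) \<omega>"
      by (simp add: quartic_def algebra_simps add_divide_distrib)
  qed (intro integrable_intros D' quartic_ess_bounded; simp)+
  finally show ?thesis .
qed

text \<open>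
  The maximal inequality of Doob. Instead of a stopping time, induction on \<open>n\<close> is used: the part of the
  event at which the level is first reached at time \<open>n + 1\<close> is estimated directly, and on the part
  where it was reached before, the submartingale inequality moves the integral from \<open>n\<close> to
  \<open>n + 1\<close>.
\<close>
lemma quartic_maximal:
  fixes c :: real and i :: 'b
  assumes "n \<ge> 1"
  defines "D \<equiv> \<lambda>n. {\<omega> \<in> space M. \<exists>k\<in>{1..n}. c \<le> quartic i k \<omega>}"
  shows "D n \<in> sets (past n)"
    and "c * prob (D n) \<le> expectation (\<lambda>\<omega>. indicator (D n) \<omega> * quartic i n \<omega>)"
proof -
  have level: "{\<omega> \<in> space M. c \<le> quartic i m \<omega>} \<in> sets (past m)" for m
  proof -
    have "{\<omega> \<in> space (past m). c \<le> quartic i m \<omega>} \<in> sets (past m)"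
      using quartic_measurable_past[of i m] by measurable
    thus ?thesis by simp
  qed
  have D: "D n \<in> sets (past n)" for n
  proof -
    have "D n = (\<Union>k\<in>{1..n}. {\<omega> \<in> space M. c \<le> quartic i k \<omega>})"
      by (auto simp: D_def)
    also have "\<dots> \<in> sets (past n)"
      using level past_mono[of _ n] by (intro sets.finite_UN) auto
    finally show ?thesis .
  qed
  thus "D n \<in> sets (past n)" .
  \<comment> \<open>Markov inequality on an event where the level is attained at the time considered.\<close>
  have first: "c * prob N \<le> expectation (\<lambda>\<omega>. indicator N \<omega> * quartic i n \<omega>)"
    if "N \<in> events" "\<And>\<omega>. \<omega> \<in> N \<Longrightarrow> c \<le> quartic i n \<omega>" for N n
  proof -
    have "c * prob N = expectation (\<lambda>\<omega>. indicator N \<omega> * c)"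
      using that by simp
    also have "\<dots> \<le> expectation (\<lambda>\<omega>. indicator N \<omega> * quartic i n \<omega>)"
      by (rule integral_mono)
         (intro integrable_intros quartic_ess_bounded that | use that in \<open>simp add: indicator_def\<close>)+
    finally show ?thesis .
  qed
  show "c * prob (D n) \<le> expectation (\<lambda>\<omega>. indicator (D n) \<omega> * quartic i n \<omega>)"
    using assms(1)
  proof (induction n rule: nat_induct_at_least)
    case base
    show ?case using D[of 1] sets_past_subset by (intro first) (auto simp: D_def)
  next
    case (Suc n)
    have ev: "D n \<in> events" "D (Suc n) \<in> events"
      using D[of n] D[of "Suc n"] sets_past_subset by blast+
    have sub: "D n \<subseteq> D (Suc n)" by (auto simp: D_def)
    let ?N = "D (Suc n) - D n"
    have "prob (D (Suc n)) = prob (D n) + prob ?N"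
      using finite_measure_Diff[OF ev(2,1) sub] by simp
    hence "c * prob (D (Suc n)) = c * prob (D n) + c * prob ?N"
      by (simp only: distrib_left)
    also have "c * prob ?N \<le> expectation (\<lambda>\<omega>. indicator ?N \<omega> * quartic i (Suc n) \<omega>)"
      using ev by (intro first) (auto simp: D_def le_Suc_eq)
    also have "c * prob (D n) \<le> expectation (\<lambda>\<omega>. indicator (D n) \<omega> * quartic i (Suc n) \<omega>)"
      using Suc.IH quartic_submartingale[OF Suc.hyps D[of n], of i] by linarith
    also have "expectation (\<lambda>\<omega>. indicator (D n) \<omega> * quartic i (Suc n) \<omega>) +
        expectation (\<lambda>\<omega>. indicator ?N \<omega> * quartic i (Suc n) \<omega>) =
      expectation (\<lambda>\<omega>. indicator (D n) \<omega> * quartic i (Suc n) \<omega> + indicator ?N \<omega> * quartic i (Suc n) \<omega>)"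
      using ev by (intro Bochner_Integration.integral_add[symmetric] integrable_intros quartic_ess_bounded) auto
    also have "\<dots> = expectation (\<lambda>\<omega>. indicator (D (Suc n)) \<omega> * quartic i (Suc n) \<omega>)"
      by (rule Bochner_Integration.integral_cong) (use sub in \<open>auto simp: indicator_def\<close>)
    finally show ?case by simp
  qed
qed

section \<open>Almost sure rate\<close>

text \<open>
  From one checkpoint to the next the logarithm about doubles, so up to constants the bound may be
  tested at checkpoints only. They are sparse enough for the exceptional probabilities to be
  summable.
\<close>
definition checkpoint :: "nat \<Rightarrow> nat"
  where "checkpoint j = nat \<lfloor>exp (2 ^ j :: real)\<rfloor>"

lemma checkpoint_ge_1: "checkpoint j \<ge> 1"
proof -
  have "exp (2 ^ j) \<ge> (1::real)" by simp
  thus ?thesis unfolding checkpoint_def by linarith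
qed

lemma ln_checkpoint_le: "ln (checkpoint j) \<le> 2 ^ j"
proof -
  have "real (checkpoint j) \<le> exp (2 ^ j)"
    unfolding checkpoint_def by (simp add: of_nat_nat)
  hence "ln (checkpoint j) \<le> ln (exp (2 ^ j :: real))"
    using checkpoint_ge_1[of j] by (subst ln_le_cancel_iff) auto
  thus ?thesis by simp
qed

lemma le_checkpoint:
  assumes "n \<ge> 1" "ln n \<le> 2 ^ j"
  shows "n \<le> checkpoint j"
proof -
  have "exp (ln n) \<le> exp (2 ^ j)" using assms(2) by simp
  hence "real n \<le> exp (2 ^ j)" using assms(1) by simp
  thus ?thesis unfolding checkpoint_def by (simp add: le_nat_iff le_floor_iff)
qed

lemma AE_eventually_quartic_less:
  "AE \<omega> in M. eventually (\<lambda>j. \<forall>k\<in>{1..checkpoint j}. quartic i k \<omega> < (2 ^ j * real j)\<^sup>2) sequentially"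
proof -
  define c where "c j = (2 ^ j * real j)\<^sup>2" for j
  define D where "D j = {\<omega> \<in> space M. \<exists>k\<in>{1..checkpoint j}. c j \<le> quartic i k \<omega>}" for j
  have D: "D j \<in> sets (past (checkpoint j))"
    "c j * prob (D j) \<le> expectation (\<lambda>\<omega>. indicator (D j) \<omega> * quartic i (checkpoint j) \<omega>)" for j
    unfolding D_def using quartic_maximal[OF checkpoint_ge_1] by blast+
  have ev: "D j \<in> events" for j using D sets_past_subset by blast
  \<comment> \<open>The bound for the fourth moment is at most \<open>(12 * (1 + 2^j))^2\<close>, the level is \<open>(2^j * j)^2\<close>.\<close>
  have bound: "prob (D j) \<le> 576 * inverse (real j ^ 2)" if "j \<ge> 1" for j
  proof -
    have "c j * prob (D j) \<le> expectation (quartic i (checkpoint j))"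
    proof (rule order_trans[OF D(2)], rule integral_mono)
      show "indicator (D j) \<omega> * quartic i (checkpoint j) \<omega> \<le> quartic i (checkpoint j) \<omega>" for \<omega>
        using quartic_nonneg[of i "checkpoint j" \<omega>] by (simp add: indicator_def)
    qed (intro integrable_intros ev quartic_ess_bounded)+
    also have "\<dots> \<le> (12 * (1 + ln (checkpoint j)))\<^sup>2"
      by (rule expectation_quartic[OF checkpoint_ge_1])
    also have "\<dots> \<le> (12 * (2 * 2 ^ j))\<^sup>2"
    proof (rule power_mono)
      have "(1::real) \<le> 2 ^ j" by simp
      thus "12 * (1 + ln (checkpoint j)) \<le> 12 * (2 * 2 ^ j)"
        using add_mono[OF _ ln_checkpoint_le[of j], of 1 "2 ^ j"] by simp
      show "0 \<le> 12 * (1 + ln (checkpoint j))"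
        using checkpoint_ge_1[of j] by simp
    qed
    finally have "(2 ^ j)\<^sup>2 * (real j ^ 2 * prob (D j)) \<le> (2 ^ j)\<^sup>2 * 576"
      by (simp add: c_def power_mult_distrib mult_ac)
    hence "real j ^ 2 * prob (D j) \<le> 576" by (rule mult_left_le_imp_le) simp
    thus ?thesis using that by (simp add: field_simps)
  qed
  have "summable (\<lambda>j. prob (D j))"
  proof (rule summable_comparison_test_ev)
    show "eventually (\<lambda>j. norm (prob (D j)) \<le> 576 * inverse (real j ^ 2)) sequentially"
      using eventually_ge_at_top[of 1] by eventually_elim (use bound in auto)
    show "summable (\<lambda>j. 576 * inverse (real j ^ 2))"
      by (intro summable_mult inverse_power_summable) auto
  qed
  hence "AE \<omega> in M. eventually (\<lambda>j. \<omega> \<in> space M - D j) sequentially"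
    by (intro borel_cantelli_AE1 ev) (auto simp: emeasure_eq_measure)
  thus ?thesis
    by eventually_elim (auto simp: D_def c_def not_le elim!: eventually_mono)
qed

text \<open>
  For each \<open>n\<close> take the first checkpoint not before it, with index \<open>j\<close> equal to \<open>log 2 (ln n)\<close>
  rounded up.
\<close>
lemma component_bound:
  assumes "eventually (\<lambda>j. \<forall>k\<in>{1..checkpoint j}. quartic i k \<omega> < (2 ^ j * real j)\<^sup>2) sequentially"
  shows "(\<lambda>n. (S n \<omega> $ i)\<^sup>2 / (real n)\<^sup>2)
    \<in> O(\<lambda>n. ln (real n) * ln (ln (real n)) / real n powr (1 + r))"
proof (rule bigoI)
  obtain J where J: "\<And>j k. j \<ge> J \<Longrightarrow> k \<in> {1..checkpoint j} \<Longrightarrow> quartic i k \<omega> < (2 ^ j * real j)\<^sup>2"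
    using assms unfolding eventually_sequentially by blast
  have "eventually (\<lambda>n::nat. ln n \<ge> 2) sequentially" "eventually (\<lambda>n::nat. log 2 (ln n) \<ge> J) sequentially"
    by real_asymp+
  thus "eventually (\<lambda>n. norm ((S n \<omega> $ i)\<^sup>2 / (real n)\<^sup>2) \<le>
      (4 / ln 2 * (exp a)\<^sup>2) * norm (ln (real n) * ln (ln (real n)) / real n powr (1 + r))) sequentially"
    using eventually_ge_at_top[of 1]
  proof eventually_elim
    case (elim n)
    let ?l = "log 2 (ln (real n))"
    have n: "n \<ge> 1" using elim by simp
    have n_neq: "n \<noteq> 1" using elim by auto
    hence l1: "?l \<ge> 1" using elim by (subst le_log_iff) auto
    define j where "j = nat \<lceil>?l\<rceil>"
    have j: "?l \<le> j" "j \<le> ?l + 1"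
      using l1 unfolding j_def by linarith+
    have lnpow: "2 powr ?l = ln n" using elim n_neq by (intro powr_log_cancel) auto
    have "ln n \<le> 2 ^ j"
      using powr_mono[OF j(1), of 2] by (simp add: lnpow powr_realpow)
    hence "n \<in> {1..checkpoint j}" using le_checkpoint[OF n] n by simp
    moreover have "j \<ge> J" using j(1) elim by linarith
    ultimately have "quartic i n \<omega> < (2 ^ j * real j)\<^sup>2" by (rule J[rotated])
    hence "((S n \<omega> $ i / growth n)\<^sup>2)\<^sup>2 \<le> (2 ^ j * real j)\<^sup>2"
      by (simp add: quartic_def)
    hence "(S n \<omega> $ i / growth n)\<^sup>2 \<le> 2 ^ j * real j"
      by (rule power2_le_imp_le) simp
    also have "\<dots> \<le> (2 * ln n) * (2 * ?l)"
    proof (rule mult_mono)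
      have "(2::real) ^ j \<le> 2 powr (?l + 1)"
        using powr_mono[OF j(2), of 2] by (simp add: powr_realpow)
      thus "2 ^ j \<le> 2 * ln n" by (simp add: powr_add lnpow)
      show "real j \<le> 2 * ?l" using j l1 by simp
    qed (use elim in auto)
    also have "\<dots> = 4 / ln 2 * (ln n * ln (ln n))" by (simp add: log_def)
    finally have 1: "(S n \<omega> $ i)\<^sup>2 \<le> 4 / ln 2 * (ln n * ln (ln n)) * (growth n)\<^sup>2"
      using growth_ge_1[of n] by (simp add: power_divide divide_le_eq)
    have 2: "(growth n)\<^sup>2 \<le> (exp a)\<^sup>2 * n powr (1 - r)"
    proof -
      have "(growth n)\<^sup>2 \<le> (exp a * n powr a)\<^sup>2"
        using growth_upper[OF n] growth_ge_1[of n] by (intro power_mono) auto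
      also have "\<dots> = (exp a)\<^sup>2 * (n powr a * n powr a)"
        by (simp add: power_mult_distrib power2_eq_square)
      also have "n powr a * n powr a = n powr (1 - r)"
        by (simp add: powr_add[symmetric] a_def)
      finally show ?thesis .
    qed
    have ll: "ln (real n) \<ge> 0" "ln (ln (real n)) \<ge> 0" using elim by auto
    have "(S n \<omega> $ i)\<^sup>2 \<le> 4 / ln 2 * (ln n * ln (ln n)) * ((exp a)\<^sup>2 * n powr (1 - r))"
      by (rule order_trans[OF 1 mult_left_mono[OF 2]]) (use ll in auto)
    hence "(S n \<omega> $ i)\<^sup>2 / (real n)\<^sup>2 \<le>
      4 / ln 2 * (ln n * ln (ln n)) * ((exp a)\<^sup>2 * n powr (1 - r)) / (real n)\<^sup>2"
      by (rule divide_right_mono) simp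
    also have "\<dots> = (4 / ln 2 * (exp a)\<^sup>2) * (ln n * ln (ln n) * (n powr (1 - r) / n powr 2))"
      using n by (simp add: powr_numeral)
    also have "n powr (1 - r) / n powr 2 = 1 / n powr (1 + r)"
      unfolding powr_diff[symmetric] powr_minus_divide[symmetric] by simp
    finally show ?case using ll by simp
  qed
qed

lemma AE_norm_bound:
  "AE \<omega> in M. (\<lambda>n. (norm (S n \<omega>))\<^sup>2 / (real n)\<^sup>2)
    \<in> O(\<lambda>n. ln (real n) * ln (ln (real n)) / real n powr (1 + r))"
proof -
  have "AE \<omega> in M. \<forall>i\<in>UNIV. eventually (\<lambda>j. \<forall>k\<in>{1..checkpoint j}. quartic i k \<omega> < (2 ^ j * real j)\<^sup>2) sequentially"
    by (intro AE_finite_allI finite AE_eventually_quartic_less)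
  thus ?thesis
  proof eventually_elim
    case (elim \<omega>)
    have "(norm (S n \<omega>))\<^sup>2 / (real n)\<^sup>2 = (\<Sum>i\<in>UNIV. (S n \<omega> $ i)\<^sup>2 / (real n)\<^sup>2)" for n
      by (simp add: norm_vec_def L2_set_def sum_nonneg sum_divide_distrib)
    thus ?case using component_bound elim by (simp only:) (rule big_sum_in_bigo, simp)
  qed
qed

lemma norm_bound_imp_tendsto_0:
  assumes "(\<lambda>n. (norm (S n \<omega>))\<^sup>2 / (real n)\<^sup>2)
    \<in> O(\<lambda>n. ln (real n) * ln (ln (real n)) / real n powr (1 + r))"
  shows "(\<lambda>n. (1 / real n) *\<^sub>R S n \<omega>) \<longlonglongrightarrow> 0"
proof -
  have "(\<lambda>n. ln (real n) * ln (ln (real n)) / real n powr (1 + r)) \<in> o(\<lambda>_. 1 :: real)"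
    using r_range by real_asymp
  with assms have "(\<lambda>n. (norm (S n \<omega>))\<^sup>2 / (real n)\<^sup>2) \<in> o(\<lambda>_. 1 :: real)"
    by (rule landau_o.big_small_trans)
  from smalloD_tendsto[OF this] have "(\<lambda>n. (norm (S n \<omega>))\<^sup>2 / (real n)\<^sup>2) \<longlonglongrightarrow> 0"
    by simp
  hence "(\<lambda>n. sqrt ((norm (S n \<omega>))\<^sup>2 / (real n)\<^sup>2)) \<longlonglongrightarrow> sqrt 0"
    by (rule tendsto_real_sqrt)
  hence "(\<lambda>n. norm ((1 / real n) *\<^sub>R S n \<omega>)) \<longlonglongrightarrow> 0"
    by (simp add: real_sqrt_divide)
  thus ?thesis by (simp only: tendsto_norm_zero_iff)
qed

end

theorem theorem3p4:
  fixes M :: "'a measure" and p q r :: real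
    and X :: "nat \<Rightarrow> 'a \<Rightarrow> real ^ ('d::{finite,linorder})"
    and U :: "nat \<Rightarrow> 'a \<Rightarrow> nat"
    and A :: "nat \<Rightarrow> 'a \<Rightarrow> real ^ ('d::{finite,linorder}) ^ ('d::{finite,linorder})"
    and S :: "nat \<Rightarrow> 'a \<Rightarrow> real ^ ('d::{finite,linorder})"
  assumes "merws M p q r X U A S"
    and "p = critical_p CARD('d) r"
  shows "(AE \<omega> in M. (\<lambda>n. (1 / real n) *\<^sub>R S n \<omega>) \<longlonglongrightarrow> 0) \<and>
    (AE \<omega> in M. (\<lambda>n. (norm (S n \<omega>))\<^sup>2 / (real n)\<^sup>2)
       \<in> O(\<lambda>n. ln (real n) * ln (ln (real n)) / real n powr (1 + r)))"
proof -
  interpret critical_merws M p q r X U A S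
    by (intro critical_merws.intro critical_merws_axioms.intro assms)
  show ?thesis
    using AE_norm_bound by (auto elim: eventually_mono intro: norm_bound_imp_tendsto_0)
qed

end
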